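(* Let $T$ be a tournament on $n$ vertices, let $t\in \mathbb{N}$ with $t\geq 2$, and let $L_1,\dots, L_t\in \mathbb{N}$ with $L_1,\dots, L_t\geq 3$ and $\sum_{j=1}^t L_j=n$. If $T$ is strongly $10^{10}t^4\log t$-connected, then $T$ contains $t$ vertex-disjoint directed cycles of lengths $L_1,\dots, L_t$ respectively.
   Context: A tournament is an orientation of a complete graph. A tournament is strongly connected if for every ordered pair of vertices $u,v$ there is a directed path from $u$ to $v$. For $k\in\mathbb{N}$, a tournament $T$ is strongly $k$-connected if $|V(T)|>k$ and the removal of any set of fewer than $k$ vertices results in a strongly connected tournament. Here $\log$ denotes $\log_2$. *)

theory Defs
  imports Complex_Main
begin

definition tournament :: "'a set \<Rightarrow> ('a \<Rightarrow> 'a \<Rightarrow> bool) \<Rightarrow> bool" where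
  "tournament V E \<longleftrightarrow> finite V
     \<and> (\<forall>u v. E u v \<longrightarrow> u \<in> V \<and> v \<in> V)
     \<and> (\<forall>v. \<not> E v v)
     \<and> (\<forall>u\<in>V. \<forall>v\<in>V. u \<noteq> v \<longrightarrow> (E u v \<longleftrightarrow> \<not> E v u))"

definition strongly_connected_on :: "'a set \<Rightarrow> ('a \<Rightarrow> 'a \<Rightarrow> bool) \<Rightarrow> bool" where
  "strongly_connected_on W E \<longleftrightarrow>
     (\<forall>u\<in>W. \<forall>v\<in>W. (\<lambda>x y. x \<in> W \<and> y \<in> W \<and> E x y)\<^sup>*\<^sup>* u v)"

definition strongly_k_connected :: "nat \<Rightarrow> 'a set \<Rightarrow> ('a \<Rightarrow> 'a \<Rightarrow> bool) \<Rightarrow> bool" where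
  "strongly_k_connected k V E \<longleftrightarrow> card V > k
     \<and> (\<forall>S. S \<subseteq> V \<and> card S < k \<longrightarrow> strongly_connected_on (V - S) E)"

definition directed_cycle :: "('a \<Rightarrow> 'a \<Rightarrow> bool) \<Rightarrow> 'a list \<Rightarrow> bool" where
  "directed_cycle E c \<longleftrightarrow> length c \<ge> 3 \<and> distinct c
     \<and> (\<forall>i < length c. E (c ! i) (c ! ((i + 1) mod length c)))"

end

(* Let a be a vertex of minimum in-degree and b one of minimum out-degree, and let a longest cycle be
   the one that takes up everything that is left over. A vertex d not dominated by a has an in-neighbour
   that a dominates, by minimality; so a family of such vertices d that dominates all the others many
   times over lets a reach everything, robustly: deleting vertices that hit only a small share of the
   family and of its in-neighbours does no harm. The same holds for b in the opposite direction.
   Menger's theorem supplies order t^2 disjoint paths, each linking a small set that is dominated by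
   almost all vertices to a small set that dominates almost all vertices, besides short paths out of b
   and into a. Averaging selects t - 1 of the linked pairs that together hit little of the families
   for a and b. Each pair absorbs almost arbitrary vertices, and strongly connected tournaments have
   cycles of all lengths, so the pairs yield the other cycles; the remaining vertices are reached from a,
   reach b, and contain a path from b to a, hence they span a strongly connected, so Hamiltonian,
   tournament. *)
theory Submission
  imports Defs "HOL-Library.Disjoint_Sets"
begin

text \<open>Only \<open>n / t\<close> vertices are guaranteed for the longest cycle, so whatever the
  shorter cycles must avoid has to be of order \<open>n / t\<close>; this budget fixes the
  constants. Dominating sets of up to \<open>t + 7\<close> vertices miss a share of about
  \<open>2 ^ -(t + 6)\<close>, which is small against \<open>1 / t\<close>. The paths from Menger's
  theorem have no length bound, and \<open>t - 1\<close> out of only order \<open>t\<close> disjoint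
  paths could fill a constant share of all vertices; out of order \<open>t ^ 2\<close> they can be
  chosen to fill at most a share \<open>1 / (8 * t)\<close>. The same average limits the damage to
  the families of \<open>a\<close> and \<open>b\<close>. The left-over set is not under control: it
  is whatever the shorter cycles happen not to use. Connectivity is therefore proved for every
  vertex set that contains a fixed small reserve. Almost dominating sets alone would not do for
  this, since their exceptional vertices may be left over; the extremal degrees of \<open>a\<close>
  and \<open>b\<close> serve to reach every vertex without exception.\<close>

section \<open>Reachability inside a vertex set, and reversal of all edges\<close>

definition reaches :: "('a \<Rightarrow> 'a \<Rightarrow> bool) \<Rightarrow> 'a set \<Rightarrow> 'a \<Rightarrow> 'a \<Rightarrow> bool" where
  "reaches E W = (\<lambda>x y. x \<in> W \<and> y \<in> W \<and> E x y)\<^sup>*\<^sup>*"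

text \<open>The empty walk has no membership test, so this holds also for \<open>u\<close> outside
  \<open>W\<close>; extracting a walk inside \<open>W\<close> therefore needs
  \<open>u \<in> W\<close> separately.\<close>

lemma reaches_refl [simp]: "reaches E W u u"
  by (simp add: reaches_def)

lemma reaches_trans [trans]: "reaches E W u v \<Longrightarrow> reaches E W v w \<Longrightarrow> reaches E W u w"
  unfolding reaches_def by (rule rtranclp_trans)

lemma reaches_edge: "u \<in> W \<Longrightarrow> v \<in> W \<Longrightarrow> E u v \<Longrightarrow> reaches E W u v"
  unfolding reaches_def by auto

lemma reaches_mono:
  assumes "reaches E W u v" "W \<subseteq> W'"
  shows "reaches E W' u v"
  using assms(1) unfolding reaches_def
proof (induction rule: rtranclp_induct)
  case (step y z)
  then show ?case using assms(2) by (auto intro: rtranclp.rtrancl_into_rtrancl)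
qed simp

text \<open>Statements about \<open>b\<close> arise from those about \<open>a\<close> by reversing
  all edges; this and the reversal lemmas below carry out the transfer.\<close>

lemma reaches_reverse: "reaches (\<lambda>x y. E y x) W u v \<longleftrightarrow> reaches E W v u"
proof -
  have *: "(\<lambda>x y. x \<in> W \<and> y \<in> W \<and> E y x) = (\<lambda>x y. x \<in> W \<and> y \<in> W \<and> E x y)\<inverse>\<inverse>"
    by (auto simp: fun_eq_iff)
  show ?thesis
    unfolding reaches_def * rtranclp_conversep conversep_iff ..
qed

lemma strongly_connected_on_iff:
  "strongly_connected_on W E \<longleftrightarrow> (\<forall>u\<in>W. \<forall>v\<in>W. reaches E W u v)"
  by (simp add: strongly_connected_on_def reaches_def)

lemma strongly_connected_onI:
  assumes "\<And>v. v \<in> W \<Longrightarrow> reaches E W a v" "\<And>v. v \<in> W \<Longrightarrow> reaches E W v b" "reaches E W b a"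
  shows "strongly_connected_on W E"
  unfolding strongly_connected_on_iff
proof (intro ballI)
  fix u v assume "u \<in> W" "v \<in> W"
  then show "reaches E W u v"
    using reaches_trans[OF assms(2) reaches_trans[OF assms(3) assms(1)]] by blast
qed

text \<open>A walk from inside \<open>X\<close> to outside must leave \<open>X\<close> along some
  edge. The growing of cycles and the degree bound use strong connectivity only in this
  form.\<close>

lemma strongly_connected_on_crossing:
  assumes "strongly_connected_on W E" "X \<subseteq> W" "X \<noteq> {}" "X \<noteq> W"
  obtains x y where "x \<in> X" "y \<in> W - X" "E x y"
proof -
  obtain u v where u: "u \<in> X" and v: "v \<in> W - X" using assms(2-4) by blast
  have "reaches E W u v" using assms(1,2) u v by (auto simp: strongly_connected_on_iff)
  then have "v \<in> X \<or> (\<exists>x\<in>X. \<exists>y\<in>W - X. E x y)"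
    unfolding reaches_def
    by (induction rule: rtranclp_induct) (use u in auto)
  then show ?thesis using v that by blast
qed

lemma tournament_reverse: "tournament V E \<Longrightarrow> tournament V (\<lambda>x y. E y x)"
  unfolding tournament_def by (elim conjE, intro conjI) blast+

lemma strongly_connected_on_reverse:
  "strongly_connected_on W (\<lambda>x y. E y x) \<longleftrightarrow> strongly_connected_on W E"
  unfolding strongly_connected_on_iff reaches_reverse[of E] by blast

lemma strongly_k_connected_reverse:
  "strongly_k_connected k V (\<lambda>x y. E y x) \<longleftrightarrow> strongly_k_connected k V E"
  unfolding strongly_k_connected_def strongly_connected_on_reverse[of _ E] ..

lemma tournament_edge_cases:
  assumes "tournament V E" "u \<in> V" "v \<in> V" "u \<noteq> v"
  shows "E u v \<or> E v u"
  using assms unfolding tournament_def by blast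

lemma tournament_asym:
  assumes T: "tournament V E" and uv: "E u v"
  shows "\<not> E v u"
proof -
  have "u \<in> V" "v \<in> V" "u \<noteq> v" using T uv unfolding tournament_def by blast+
  then show ?thesis using T uv unfolding tournament_def by blast
qed

section \<open>Cycles of all lengths in strongly connected tournaments\<close>

text \<open>Trades index arithmetic modulo the length for list operations, so that cycles can be
  cut, rotated and spliced.\<close>

lemma directed_cycle_iff:
  "directed_cycle E c \<longleftrightarrow>
     3 \<le> length c \<and> distinct c \<and> successively E c \<and> E (last c) (hd c)"
proof (cases "3 \<le> length c")
  case True
  have "(\<forall>i < length c. E (c ! i) (c ! ((i + 1) mod length c))) \<longleftrightarrow>
        (\<forall>i < length c - 1. E (c ! i) (c ! Suc i)) \<and> E (c ! (length c - 1)) (c ! 0)" (is "?L \<longleftrightarrow> ?R")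
  proof
    assume L: ?L
    have "E (c ! i) (c ! Suc i)" if "i < length c - 1" for i
      using L[rule_format, of i] that by simp
    moreover have "E (c ! (length c - 1)) (c ! 0)"
      using L[rule_format, of "length c - 1"] True by (cases c) auto
    ultimately show ?R by blast
  next
    assume R: ?R
    show ?L
    proof (intro allI impI)
      fix i assume i: "i < length c"
      show "E (c ! i) (c ! ((i + 1) mod length c))"
      proof (cases "i = length c - 1")
        case True
        then have "Suc i = length c" using i by simp
        then show ?thesis using R True by simp
      next
        case False
        then show ?thesis using R i by simp
      qed
    qed
  qed
  moreover have "c \<noteq> []" using True by auto
  moreover have "Suc i < length c \<longleftrightarrow> i < length c - 1" for i by linarith
  ultimately show ?thesis
    using True by (simp add: directed_cycle_def successively_conv_nth last_conv_nth hd_conv_nth)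
qed (simp add: directed_cycle_def)

lemma directed_cycle_rotate:
  assumes "directed_cycle E (us @ vs)"
  shows "directed_cycle E (vs @ us)"
proof (cases "us = [] \<or> vs = []")
  case False
  with assms show ?thesis
    by (auto simp: directed_cycle_iff successively_append_iff)
qed (use assms in auto)

text \<open>Walk round the cycle from \<open>p\<close> to the first vertex \<open>y\<close>
  dominated by \<open>v\<close>. Its predecessor is \<open>p\<close> or is not dominated by
  \<open>v\<close>, so it dominates \<open>v\<close>, and \<open>v\<close> fits between the
  two.\<close>

lemma directed_cycle_insert:
  assumes T: "tournament V E" and c: "directed_cycle E c" "set c \<subseteq> V" and v: "v \<in> V" "v \<notin> set c"
    and pq: "p \<in> set c" "E p v" "q \<in> set c" "E v q"
  obtains c' where "directed_cycle E c'" "length c' = Suc (length c)" "set c' = insert v (set c)"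
proof -
  obtain us vs where us: "c = us @ p # vs" using split_list[OF pq(1)] by blast
  define ys where "ys = vs @ us"
  have cyc: "directed_cycle E (p # ys)"
    using directed_cycle_rotate[of E us "p # vs"] c(1) us by (simp add: ys_def)
  have set_ys: "set c = insert p (set ys)" and len_ys: "length c = Suc (length ys)"
    using us by (auto simp: ys_def)
  have "\<exists>y\<in>set ys. E v y"
    using pq set_ys tournament_asym[OF T pq(2)] by auto
  then obtain as y bs where y: "ys = as @ y # bs" "E v y" "\<forall>u\<in>set as. \<not> E v u"
    using split_list_first_prop[of ys "E v"] by blast
  have "E (last (p # as)) v"
  proof (cases "as = []")
    case False
    then have "last as \<in> set as" by simp
    moreover from this have "last as \<in> V" "last as \<noteq> v"
      using c(2) v set_ys unfolding y(1) by auto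
    ultimately show ?thesis
      using tournament_edge_cases[OF T _ v(1), of "last as"] y(3) False by auto
  qed (use pq in simp)
  moreover have "successively E ((p # as) @ y # bs)" "distinct ((p # as) @ y # bs)"
      "E (last (y # bs)) p"
    using cyc unfolding y(1) directed_cycle_iff by simp_all
  moreover have "v \<notin> set ((p # as) @ y # bs)"
    using v(2) set_ys unfolding y(1) by simp
  ultimately have "successively E ((p # as) @ v # y # bs)" "distinct ((p # as) @ v # y # bs)"
      "E (last (v # y # bs)) p"
    using y(2) unfolding successively_append_iff by auto
  then have "directed_cycle E (p # as @ v # y # bs)"
    by (simp add: directed_cycle_iff)
  then show ?thesis
    by (rule that) (use set_ys len_ys in \<open>auto simp: y(1)\<close>)
qed

text \<open>If no outside vertex can be inserted, each one is dominated by the whole cycle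
  (\<open>X\<close>) or dominates the whole cycle (\<open>Z\<close>). Strong connectivity forces an
  edge from some \<open>x\<close> in \<open>X\<close> to some \<open>z\<close> in \<open>Z\<close>,
  and replacing one cycle vertex by \<open>x, z\<close> lengthens the cycle by one. That vertex is
  lost, so the new cycle need not contain the old one.\<close>

lemma directed_cycle_extend:
  assumes T: "tournament V E" and W: "W \<subseteq> V" "strongly_connected_on W E"
    and c: "directed_cycle E c" "set c \<subset> W"
  obtains c' where "directed_cycle E c'" "length c' = Suc (length c)" "set c' \<subseteq> W"
proof (cases "\<exists>v\<in>W - set c. (\<exists>p\<in>set c. E p v) \<and> (\<exists>q\<in>set c. E v q)")
  case True
  then obtain v p q where v: "v \<in> W - set c" "p \<in> set c" "E p v" "q \<in> set c" "E v q" by blast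
  have "set c \<subseteq> V" "v \<in> V" "v \<notin> set c" using W(1) c(2) v(1) by auto
  from directed_cycle_insert[OF T c(1) this v(2-5)] obtain c'
    where c': "directed_cycle E c'" "length c' = Suc (length c)" "set c' = insert v (set c)" .
  show ?thesis
    by (rule that[OF c'(1,2)]) (use c'(3) v(1) c(2) in auto)
next
  case False
  define X where "X = {v\<in>W - set c. \<forall>p\<in>set c. E p v}"
  define Z where "Z = {v\<in>W - set c. \<forall>p\<in>set c. E v p}"
  have XZ: "v \<in> X \<or> v \<in> Z" if "v \<in> W - set c" for v
  proof -
    have "\<forall>p\<in>set c. E p v \<or> E v p"
      using tournament_edge_cases[OF T] that c(2) W(1) by blast
    then show ?thesis using False that unfolding X_def Z_def by blast
  qed
  have ne: "set c \<noteq> {}" using c(1) by (auto simp: directed_cycle_def)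
  have "set c \<subseteq> W" "set c \<noteq> W" using c(2) by auto
  obtain x0 y0 where "x0 \<in> set c" "y0 \<in> W - set c" "E x0 y0"
    using strongly_connected_on_crossing[OF W(2) \<open>set c \<subseteq> W\<close> ne \<open>set c \<noteq> W\<close>] .
  then have "y0 \<in> X" using XZ[of y0] tournament_asym[OF T] unfolding Z_def by blast
  then have "X \<noteq> {}" by blast
  moreover have "X \<subseteq> W" by (auto simp: X_def)
  moreover have "\<exists>w. w \<in> W - X" using c(2) ne by (auto simp: X_def neq_Nil_conv)
  then have "X \<noteq> W" by blast
  ultimately obtain x z where x: "x \<in> X" "z \<in> W - X" "E x z"
    using strongly_connected_on_crossing[OF W(2)] by metis
  have "z \<notin> set c" using x tournament_asym[OF T] unfolding X_def by blast
  then have z: "z \<in> Z" using x XZ by blast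
  obtain c1 c2 cs where cs: "c = c1 # c2 # cs" "cs \<noteq> []"
    using c(1) unfolding directed_cycle_iff
    by (cases c; cases "tl c"; cases "tl (tl c)") auto
  have "x \<noteq> z" using x by auto
  moreover have "x \<notin> set c" "z \<notin> set c" "E c1 x" "E z (hd cs)"
    using x(1) z cs unfolding X_def Z_def by auto
  ultimately have "directed_cycle E (c1 # x # z # cs)"
    using c(1) x(3) cs unfolding directed_cycle_iff
    by (auto simp: successively_Cons)
  moreover have "set (c1 # x # z # cs) \<subseteq> W"
    using x z cs c(2) unfolding X_def Z_def by auto
  ultimately show ?thesis
    by (intro that[of "c1 # x # z # cs"]) (use cs in simp_all)
qed

text \<open>Moon's theorem; the case \<open>m = card W\<close> provides the Hamiltonian cycle on the
  left-over vertices.\<close>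

theorem strongly_connected_cycle_of_length:
  assumes T: "tournament V E" and W: "W \<subseteq> V" "strongly_connected_on W E"
    and m: "3 \<le> m" "m \<le> card W"
  shows "\<exists>c. directed_cycle E c \<and> length c = m \<and> set c \<subseteq> W"
  using m
proof (induction m rule: dec_induct)
  case base
  have "W \<noteq> {}" using base by auto
  then obtain v where v: "v \<in> W" by blast
  \<comment> \<open>An edge from \<open>x\<close> to \<open>y\<close> leaving the out-neighbourhood
    of \<open>v\<close> closes a triangle: \<open>y\<close> is neither \<open>v\<close> nor
    dominated by \<open>v\<close>, so it dominates \<open>v\<close>.\<close>
  define X where "X = {y\<in>W. E v y}"
  have irr: "\<not> E u u" for u using T by (auto simp: tournament_def)
  have nW: "{v} \<noteq> W" using base by auto
  obtain x0 where "x0 \<in> X"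
    using strongly_connected_on_crossing[OF W(2) _ _ nW] v unfolding X_def by auto
  moreover have "X \<subseteq> W" "X \<noteq> W" using v irr unfolding X_def by auto
  ultimately obtain x y where xy: "x \<in> X" "y \<in> W - X" "E x y"
    using strongly_connected_on_crossing[OF W(2)] by (metis empty_iff)
  have "y \<noteq> v" using xy tournament_asym[OF T] by (auto simp: X_def)
  then have "E y v" using xy(2) tournament_edge_cases[OF T] W(1) v by (auto simp: X_def)
  then have "directed_cycle E [v, x, y]"
    using xy irr \<open>y \<noteq> v\<close> by (auto simp: directed_cycle_iff X_def)
  then show ?case using v xy by (intro exI[of _ "[v, x, y]"]) (auto simp: X_def)
next
  case (step m)
  then obtain c where c: "directed_cycle E c" "length c = m" "set c \<subseteq> W" by auto
  then have "card (set c) < card W" using step.prems by (simp add: directed_cycle_def distinct_card)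
  then have "set c \<subset> W" using c(3) by auto
  from directed_cycle_extend[OF T W c(1) this] obtain c'
    where "directed_cycle E c'" "length c' = Suc (length c)" "set c' \<subseteq> W" .
  then show ?case using c(2) by auto
qed

section \<open>Menger's theorem\<close>

text \<open>Walks instead of paths: only disjointness of different walks matters, so repetitions may
  stay. A single vertex of \<open>A \<inter> B\<close> counts. The edges form a set of pairs so that
  Menger's theorem can be proved by induction on it.\<close>

definition links :: "('a \<times> 'a) set \<Rightarrow> 'a set \<Rightarrow> 'a set \<Rightarrow> 'a list \<Rightarrow> bool" where
  "links D A B p \<longleftrightarrow> p \<noteq> [] \<and> successively (\<lambda>x y. (x, y) \<in> D) p \<and> hd p \<in> A \<and> last p \<in> B"

definition separates :: "('a \<times> 'a) set \<Rightarrow> 'a set \<Rightarrow> 'a set \<Rightarrow> 'a set \<Rightarrow> bool" where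
  "separates D A B S \<longleftrightarrow> (\<forall>p. links D A B p \<longrightarrow> set p \<inter> S \<noteq> {})"

lemma links_mono: "links D A B p \<Longrightarrow> D \<subseteq> D' \<Longrightarrow> links D' A B p"
  unfolding links_def by (auto intro: successively_mono)

lemma links_reverse: "links (D\<inverse>) B A (rev p) \<longleftrightarrow> links D A B p"
  unfolding links_def by (auto simp: hd_rev last_rev)

lemma separates_reverse: "separates (D\<inverse>) B A S \<longleftrightarrow> separates D A B S"
  unfolding separates_def using links_reverse[of D B A] by (metis rev_rev_ident set_rev)

lemma separates_linksD: "separates D A B S \<Longrightarrow> links D A B p \<Longrightarrow> set p \<inter> S \<noteq> {}"
  unfolding separates_def by blast

lemma links_prefix:
  assumes "links D A B p" "set p \<inter> C \<noteq> {}"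
  obtains us z where "z \<in> C" "set us \<inter> C = {}" "links D A C (us @ [z])" "set (us @ [z]) \<subseteq> set p"
proof -
  obtain us z vs where "p = us @ z # vs" "z \<in> C" "\<forall>y\<in>set us. y \<notin> C"
    using split_list_first_prop[of p "\<lambda>y. y \<in> C"] assms(2) by blast
  with assms(1) show ?thesis
    by (intro that[of z us]) (auto simp: links_def successively_append_iff hd_append split: if_splits)
qed

text \<open>Edges are traversed from non-final positions only, and these all lie in
  \<open>us\<close>; hence even \<open>z = x\<close> is harmless.\<close>

lemma links_remove_edge:
  assumes "links D A B (us @ [z])" "x \<notin> set us"
  shows "links (D - {(x, y)}) A B (us @ [z])"
proof -
  have "successively (\<lambda>a b. (a, b) \<in> D - {(x, y)}) us"
    using assms by (auto simp: links_def successively_append_iff elim!: successively_mono)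
  then show ?thesis
    using assms by (cases "us = []") (auto simp: links_def successively_append_iff)
qed

text \<open>Up to its first vertex in \<open>insert x S\<close> a link has not left
  \<open>x\<close>, so this piece avoids the deleted edge and must meet \<open>X\<close>
  already.\<close>

lemma separates_prefix:
  assumes S: "separates D A B (insert x S)" and X: "separates (D - {(x, y)}) A (insert x S) X"
  shows "separates D A B X"
  unfolding separates_def
proof (intro allI impI)
  fix p assume "links D A B p"
  moreover from this have "set p \<inter> insert x S \<noteq> {}"
    using S by (meson separates_linksD)
  ultimately obtain us z where us: "z \<in> insert x S" "set us \<inter> insert x S = {}"
      "links D A (insert x S) (us @ [z])" "set (us @ [z]) \<subseteq> set p"
    using links_prefix by metis
  have "links (D - {(x, y)}) A (insert x S) (us @ [z])"
    using links_remove_edge[OF us(3)] us(2) by blast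
  then show "set p \<inter> X \<noteq> {}"
    using separates_linksD[OF X] us(4) by blast
qed

lemma separates_suffix:
  assumes S: "separates D A B (insert y S)" and X: "separates (D - {(x, y)}) (insert y S) B X"
  shows "separates D A B X"
proof -
  have "(D - {(x, y)})\<inverse> = D\<inverse> - {(y, x)}" by auto
  then show ?thesis
    using separates_prefix[of "D\<inverse>" B A y S x X] S X separates_reverse by metis
qed

text \<open>A link that misses one end of the edge survives its deletion and is caught by
  \<open>S\<close>; all others contain both ends.\<close>

lemma separates_insert_edge_end:
  assumes "separates (D - {(x, y)}) A B S"
  shows "separates D A B (insert x S)" "separates D A B (insert y S)"
proof -
  have *: "links (D - {(x, y)}) A B p" if "links D A B p" "x \<notin> set p \<or> y \<notin> set p" for p
    using that unfolding links_def by (auto elim!: successively_mono)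
  show "separates D A B (insert x S)" "separates D A B (insert y S)"
    using * assms unfolding separates_def by blast+
qed

text \<open>Truncate each walk at its first vertex in \<open>C\<close>. Disjointness makes the new
  end points distinct, and by \<open>card F = card C\<close> they exhaust \<open>C\<close>, so the
  walks can be indexed by their ends.\<close>

lemma linkage_onto:
  assumes F: "finite F" "card F = card C" "\<forall>p\<in>F. links D A C p"
    and dis: "\<forall>p\<in>F. \<forall>q\<in>F. p \<noteq> q \<longrightarrow> set p \<inter> set q = {}" and C: "finite C"
  obtains g where "\<And>z. z \<in> C \<Longrightarrow> links D A C (g z @ [z])" "\<And>z. z \<in> C \<Longrightarrow> set (g z) \<inter> C = {}"
    "\<And>z w. z \<in> C \<Longrightarrow> w \<in> C \<Longrightarrow> z \<noteq> w \<Longrightarrow> set (g z @ [z]) \<inter> set (g w @ [w]) = {}"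
proof -
  have "\<exists>us z. z \<in> C \<and> set us \<inter> C = {} \<and> links D A C (us @ [z]) \<and> set (us @ [z]) \<subseteq> set p"
    if p: "p \<in> F" for p
  proof -
    have l: "links D A C p" using F(3) p by blast
    then have "last p \<in> set p \<inter> C" by (auto simp: links_def)
    then have "set p \<inter> C \<noteq> {}" by blast
    from links_prefix[OF l this] show ?thesis by metis
  qed
  then obtain u z where uz: "\<And>p. p \<in> F \<Longrightarrow> z p \<in> C \<and> set (u p) \<inter> C = {} \<and>
      links D A C (u p @ [z p]) \<and> set (u p @ [z p]) \<subseteq> set p"
    by metis
  have "inj_on z F"
    using uz dis by (intro inj_onI) (metis IntI UnCI empty_iff list.set_intros(1) set_append subsetD)
  moreover have "z ` F \<subseteq> C" using uz by blast
  ultimately have bij: "bij_betw z F C"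
    using F C by (metis bij_betw_def card_image card_subset_eq)
  define f where "f = inv_into F z"
  have f: "f c \<in> F" "z (f c) = c" if "c \<in> C" for c
    using that bij unfolding f_def
    by (metis bij_betw_def inv_into_into) (metis bij bij_betw_inv_into_right that)
  show ?thesis
  proof (rule that[of "\<lambda>c. u (f c)"])
    fix c w assume cw: "c \<in> C" "w \<in> C" "c \<noteq> w"
    then have "f c \<noteq> f w" using f by metis
    then have "set (f c) \<inter> set (f w) = {}" using dis f cw by blast
    then show "set (u (f c) @ [c]) \<inter> set (u (f w) @ [w]) = {}"
      using uz[of "f c"] uz[of "f w"] f cw by auto
  qed (use uz f in force)+
qed

lemma linkage_from:
  assumes F: "finite F" "card F = card C" "\<forall>p\<in>F. links D C B p"
    and dis: "\<forall>p\<in>F. \<forall>q\<in>F. p \<noteq> q \<longrightarrow> set p \<inter> set q = {}" and C: "finite C"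
  obtains h where "\<And>z. z \<in> C \<Longrightarrow> links D C B (z # h z)" "\<And>z. z \<in> C \<Longrightarrow> set (h z) \<inter> C = {}"
    "\<And>z w. z \<in> C \<Longrightarrow> w \<in> C \<Longrightarrow> z \<noteq> w \<Longrightarrow> set (z # h z) \<inter> set (w # h w) = {}"
proof -
  have "card (rev ` F) = card C" using F(2) by (simp add: card_image)
  moreover have "\<forall>p\<in>rev ` F. links (D\<inverse>) B C p" using F(3) links_reverse by blast
  moreover have "\<forall>p\<in>rev ` F. \<forall>q\<in>rev ` F. p \<noteq> q \<longrightarrow> set p \<inter> set q = {}" using dis by auto
  ultimately obtain g where g: "\<And>z. z \<in> C \<Longrightarrow> links (D\<inverse>) B C (g z @ [z])"
      "\<And>z. z \<in> C \<Longrightarrow> set (g z) \<inter> C = {}"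
      "\<And>z w. z \<in> C \<Longrightarrow> w \<in> C \<Longrightarrow> z \<noteq> w \<Longrightarrow> set (g z @ [z]) \<inter> set (g w @ [w]) = {}"
    using linkage_onto[of "rev ` F" C "D\<inverse>" B] F(1) C by (metis finite_imageI)
  show ?thesis
  proof (rule that[of "\<lambda>z. rev (g z)"])
    fix z assume "z \<in> C"
    then show "links D C B (z # rev (g z))"
      using g(1)[of z] links_reverse[of D B C "z # rev (g z)"] by simp
  qed (use g in auto)
qed

text \<open>Goering's proof: if deleting an edge \<open>x \<rightarrow> y\<close> creates a small separator \<open>S\<close>, then linkages onto
  \<open>insert x S\<close> and from \<open>insert y S\<close> exist without that edge and can only meet in \<open>S\<close>.\<close>
theorem menger:
  assumes "finite D" "finite A" "finite B"
    and "\<And>S. finite S \<Longrightarrow> separates D A B S \<Longrightarrow> k \<le> card S"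
  shows "\<exists>F. finite F \<and> card F = k \<and> (\<forall>p\<in>F. links D A B p) \<and>
             (\<forall>p\<in>F. \<forall>q\<in>F. p \<noteq> q \<longrightarrow> set p \<inter> set q = {})"
  using assms
proof (induction D arbitrary: A B rule: finite_induct)
  case empty
  \<comment> \<open>Without edges a link is a single vertex of \<open>A \<inter> B\<close>, so that
    set separates.\<close>
  have "p = [hd p]" "hd p \<in> A \<inter> B" if "links {} A B p" for p
    using that by (cases p; cases "tl p"; simp add: links_def)+
  then have "separates {} A B (A \<inter> B)"
    unfolding separates_def by (metis IntI empty_iff list.set_sel(1) links_def)
  then have "k \<le> card (A \<inter> B)" using empty by blast
  then obtain C where "C \<subseteq> A \<inter> B" "card C = k" "finite C" using obtain_subset_with_card_n by metis
  then show ?case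
    by (intro exI[of _ "(\<lambda>v. [v]) ` C"]) (auto simp: card_image inj_on_def links_def)
next
  case (insert e D)
  obtain x y where e: "e = (x, y)" by (cases e)
  define D' where "D' = insert e D"
  have D: "D = D' - {(x, y)}" using insert.hyps e by (auto simp: D'_def)
  show ?case
  proof (cases "\<forall>S. finite S \<and> separates D A B S \<longrightarrow> k \<le> card S")
    case True
    then obtain F where "finite F" "card F = k" "\<forall>p\<in>F. links D A B p"
        "\<forall>p\<in>F. \<forall>q\<in>F. p \<noteq> q \<longrightarrow> set p \<inter> set q = {}"
      using insert.IH[of A B] insert.prems by blast
    then show ?thesis
      using links_mono[of D A B _ "insert e D"] by (intro exI[of _ F]) blast
  next
    case False
    then obtain S where S: "finite S" "separates D A B S" "card S < k" by force
    have sx: "separates D' A B (insert x S)" and sy: "separates D' A B (insert y S)"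
      using separates_insert_edge_end[of D' x y A B S] S(2) D by auto
    have k: "k \<le> card (insert x S)" "k \<le> card (insert y S)"
      using insert.prems(3) sx sy S(1) unfolding D'_def by simp_all
    \<comment> \<open>Both enlarged sets separate in the full graph, hence have at least
      \<open>k\<close> elements; so \<open>S\<close> has exactly \<open>k - 1\<close> and contains
      neither end of the edge.\<close>
    with S have nin: "x \<notin> S" "y \<notin> S" and card: "card (insert x S) = k" "card (insert y S) = k"
      by (auto simp: card_insert_if split: if_splits)
    have "k \<le> card X" if "finite X" "separates D A (insert x S) X" for X
      using insert.prems(3)[OF that(1)] separates_prefix[OF sx, of y X] that(2)
      unfolding D'_def[symmetric] D[symmetric] by blast
    then obtain F1 where F1: "finite F1" "card F1 = k" "\<forall>p\<in>F1. links D A (insert x S) p"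
        "\<forall>p\<in>F1. \<forall>q\<in>F1. p \<noteq> q \<longrightarrow> set p \<inter> set q = {}"
      using insert.IH[of A "insert x S"] insert.prems S(1) by (metis finite_insert)
    have "k \<le> card X" if "finite X" "separates D (insert y S) B X" for X
      using insert.prems(3)[OF that(1)] separates_suffix[OF sy, of x X] that(2)
      unfolding D'_def[symmetric] D[symmetric] by blast
    then obtain F2 where F2: "finite F2" "card F2 = k" "\<forall>p\<in>F2. links D (insert y S) B p"
        "\<forall>p\<in>F2. \<forall>q\<in>F2. p \<noteq> q \<longrightarrow> set p \<inter> set q = {}"
      using insert.IH[of "insert y S" B] insert.prems S(1) by (metis finite_insert)
    obtain g where g: "\<And>z. z \<in> insert x S \<Longrightarrow> links D A (insert x S) (g z @ [z])"
        "\<And>z. z \<in> insert x S \<Longrightarrow> set (g z) \<inter> insert x S = {}"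
        "\<And>z w. z \<in> insert x S \<Longrightarrow> w \<in> insert x S \<Longrightarrow> z \<noteq> w \<Longrightarrow> set (g z @ [z]) \<inter> set (g w @ [w]) = {}"
      using linkage_onto[OF F1(1) _ F1(3,4)] F1(2) S(1) card by (metis finite_insert)
    obtain h where h: "\<And>z. z \<in> insert y S \<Longrightarrow> links D (insert y S) B (z # h z)"
        "\<And>z. z \<in> insert y S \<Longrightarrow> set (h z) \<inter> insert y S = {}"
        "\<And>z w. z \<in> insert y S \<Longrightarrow> w \<in> insert y S \<Longrightarrow> z \<noteq> w \<Longrightarrow> set (z # h z) \<inter> set (w # h w) = {}"
      using linkage_from[OF F2(1) _ F2(3,4)] F2(2) S(1) card by (metis finite_insert)
    \<comment> \<open>At a meeting point outside \<open>S\<close>, the first walk could be continued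
      along the second; the result would be a link without the deleted edge that avoids
      \<open>S\<close>.\<close>
    have meet: "v \<in> S" if z: "z \<in> insert x S" "v \<in> set (g z @ [z])"
      and w: "w \<in> insert y S" "v \<in> set (w # h w)" for z w v
    proof (rule ccontr)
      assume v: "v \<notin> S"
      obtain us vs where us: "g z @ [z] = us @ v # vs" using z(2) by (meson split_list)
      obtain us' vs' where us': "w # h w = us' @ v # vs'" using w(2) by (meson split_list)
      have "set us \<subseteq> set (g z)" using us by (metis butlast_append butlast_snoc list.distinct(1) set_append sup_ge1)
      moreover have "set vs' \<subseteq> set (h w)" using us' by (cases us') auto
      ultimately have "set (us @ v # vs') \<inter> S = {}" using g(2)[OF z(1)] h(2)[OF w(1)] v by auto
      moreover have "links D A B (us @ v # vs')"
        using g(1)[OF z(1)] h(1)[OF w(1)] unfolding us us'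
        by (auto simp: links_def successively_append_iff hd_append split: if_splits)
      ultimately show False using separates_linksD[OF S(2)] by blast
    qed
    \<comment> \<open>The walk ending in \<open>x\<close> is joined to the walk starting in
      \<open>y\<close> by the deleted edge itself; all others are glued at their common vertex of
      \<open>S\<close>. The map \<open>c\<close> records where the second half starts.\<close>
    define f where "f z = (if z = x then g x @ x # y # h y else g z @ z # h z)" for z
    define c where "c z = (if z = x then y else z)" for z
    have c: "c z \<in> insert y S" "c z = c w \<longleftrightarrow> z = w"
      if "z \<in> insert x S" "w \<in> insert x S" for z w
      using that nin by (auto simp: c_def)
    have set_f: "set (f z) = set (g z @ [z]) \<union> set (c z # h (c z))" for z
      by (auto simp: f_def c_def)
    have links_f: "links D' A B (f z)" if z: "z \<in> insert x S" for z
    proof -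
      have "links D' A (insert x S) (g z @ [z])" "links D' (insert y S) B (c z # h (c z))"
        using g(1)[OF z] h(1)[OF c(1)[OF z z]] by (auto intro: links_mono simp: D'_def)
      moreover have "(x, y) \<in> D'" by (simp add: D'_def e)
      ultimately show ?thesis
        unfolding f_def c_def
        by (auto simp: links_def successively_append_iff hd_append successively_Cons split: if_splits)
    qed
    have dis: "set (f z) \<inter> set (f w) = {}" if zw: "z \<in> insert x S" "w \<in> insert x S" "z \<noteq> w" for z w
    proof -
      have cross: "set (g z @ [z]) \<inter> set (c w # h (c w)) = {}"
        if zw: "z \<in> insert x S" "w \<in> insert x S" "z \<noteq> w" for z w
      proof (rule ccontr)
        assume "\<not> ?thesis"
        then obtain v where v: "v \<in> set (g z @ [z])" "v \<in> set (c w # h (c w))" by blast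
        have "v \<in> S" using meet[OF zw(1) v(1) _ v(2)] c zw by blast
        then have "v = z" "v = c w" using v g(2)[OF zw(1)] h(2)[of "c w"] c[OF zw(2) zw(2)] by auto
        then show False using zw \<open>v \<in> S\<close> nin by (auto simp: c_def split: if_splits)
      qed
      have "set (g z @ [z]) \<inter> set (g w @ [w]) = {}" using g(3) zw by blast
      moreover have "set (c z # h (c z)) \<inter> set (c w # h (c w)) = {}"
        using h(3) c zw by metis
      moreover have "set (g w @ [w]) \<inter> set (c z # h (c z)) = {}" using cross[of w z] zw by blast
      ultimately show ?thesis unfolding set_f using cross[OF zw] by blast
    qed
    have "inj_on f (insert x S)"
    proof (rule inj_onI, rule ccontr)
      fix z w assume "z \<in> insert x S" "w \<in> insert x S" and eq: "f z = f w" and "z \<noteq> w"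
      then have "set (f z) \<inter> set (f w) = {}" by (intro dis)
      moreover have "z \<in> set (f z)" by (simp add: set_f)
      ultimately show False unfolding eq by simp
    qed
    then have "card (f ` insert x S) = k" using card(1) by (metis card_image)
    then show ?thesis
      using S(1) links_f dis unfolding D'_def
      by (intro exI[of _ "f ` insert x S"] conjI ballI impI) auto
  qed
qed

section \<open>Disjoint paths in highly connected tournaments\<close>

lemma reaches_successively:
  assumes "successively E (u # p)" "set (u # p) \<subseteq> W" "v \<in> set (u # p)"
  shows "reaches E W u v"
  using assms
proof (induction p arbitrary: u)
  case (Cons w p)
  then show ?case by (auto intro: reaches_trans[OF reaches_edge])
qed simp

lemma reaches_imp_successively:
  assumes "reaches E W u v" "u \<in> W"
  obtains p where "p \<noteq> []" "successively (\<lambda>x y. x \<in> W \<and> y \<in> W \<and> E x y) p" "hd p = u" "last p = v" "set p \<subseteq> W"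
proof -
  have "\<exists>p. p \<noteq> [] \<and> successively (\<lambda>x y. x \<in> W \<and> y \<in> W \<and> E x y) p \<and> hd p = u \<and> last p = v \<and> set p \<subseteq> W"
    using assms(1) unfolding reaches_def
  proof (induction rule: rtranclp_induct)
    case base
    then show ?case using assms(2) by (intro exI[of _ "[u]"]) auto
  next
    case (step v w)
    then obtain p where "p \<noteq> [] \<and> successively (\<lambda>x y. x \<in> W \<and> y \<in> W \<and> E x y) p \<and> hd p = u \<and> last p = v \<and> set p \<subseteq> W" by blast
    then show ?case using step.hyps by (intro exI[of _ "p @ [w]"]) (auto simp: successively_append_iff)
  qed
  then show ?thesis using that by blast
qed

text \<open>Connection by disjoint paths, recorded only through the vertex set \<open>P u\<close> of the path
  starting at \<open>u\<close> and its end point \<open>e u\<close>.\<close>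
theorem strongly_k_connected_linkage:
  assumes T: "tournament V E" and conn: "strongly_k_connected k V E"
    and Z: "Z \<subseteq> V" "card Z + m \<le> k"
    and A: "A \<subseteq> V - Z" "card A = m" and B: "B \<subseteq> V - Z" "card B = m"
  obtains P e where "\<And>u. u \<in> A \<Longrightarrow> P u \<subseteq> V - Z" "\<And>u. u \<in> A \<Longrightarrow> u \<in> P u" "\<And>u. u \<in> A \<Longrightarrow> e u \<in> P u"
    "\<And>u. u \<in> A \<Longrightarrow> reaches E (P u) u (e u)" "disjoint_family_on P A" "bij_betw e A B"
proof -
  have finV: "finite V" using T by (simp add: tournament_def)
  then have fin: "finite A" "finite B" "finite Z" using A B Z by (auto intro: finite_subset)
  define D where "D = {(x, y). x \<in> V - Z \<and> y \<in> V - Z \<and> E x y}"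
  have "finite D" using finV by (intro finite_subset[of D "V \<times> V"]) (auto simp: D_def)
  have "m \<le> card S" if S: "finite S" "separates D A B S" for S
  proof (rule ccontr)
    assume "\<not> m \<le> card S"
    then have lt: "card S < m" by simp
    then have "\<not> A \<subseteq> S" "\<not> B \<subseteq> S" 
      using card_mono[OF S(1), of A] card_mono[OF S(1), of B] A(2) B(2) by auto
    then obtain u v where u: "u \<in> A" "u \<notin> S" and v: "v \<in> B" "v \<notin> S" by blast
    \<comment> \<open>A separator may contain elements outside \<open>V\<close>; intersecting with
      \<open>V\<close> yields a deletion set to which the connectivity hypothesis applies.\<close>
    define W where "W = V - (Z \<union> (S \<inter> V))"
    have "card (Z \<union> (S \<inter> V)) < k"
      using card_Un_le[of Z "S \<inter> V"] card_mono[OF S(1), of "S \<inter> V"] lt Z(2) by simp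
    moreover have "Z \<union> (S \<inter> V) \<subseteq> V" using Z(1) by blast
    ultimately have "strongly_connected_on W E"
      unfolding W_def by (intro conn[unfolded strongly_k_connected_def, THEN conjunct2, rule_format] conjI)
    moreover have "u \<in> W" "v \<in> W" using u v A B by (auto simp: W_def)
    ultimately have "reaches E W u v" by (auto simp: strongly_connected_on_iff)
    from reaches_imp_successively[OF this \<open>u \<in> W\<close>]
    obtain p where p: "p \<noteq> []" "successively (\<lambda>x y. x \<in> W \<and> y \<in> W \<and> E x y) p"
        "hd p = u" "last p = v" "set p \<subseteq> W" .
    then have "links D A B p"
      using u v by (auto simp: links_def D_def W_def elim!: successively_mono)
    then show False using separates_linksD[OF S(2)] p(5) by (auto simp: W_def)
  qed
  then obtain F where F: "finite F" "card F = m" "\<forall>p\<in>F. links D A B p"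
      "\<forall>p\<in>F. \<forall>q\<in>F. p \<noteq> q \<longrightarrow> set p \<inter> set q = {}"
    using menger[OF \<open>finite D\<close> fin(1,2)] by metis
  obtain h where h: "\<And>z. z \<in> A \<Longrightarrow> links D A B (z # h z)"
      "\<And>z w. z \<in> A \<Longrightarrow> w \<in> A \<Longrightarrow> z \<noteq> w \<Longrightarrow> set (z # h z) \<inter> set (w # h w) = {}"
    using linkage_from[OF F(1) _ F(3,4) fin(1)] F(2) A(2) by metis
  define P where "P z = set (z # h z)" for z
  define e where "e z = last (z # h z)" for z
  have e: "e z \<in> P z" "e z \<in> B" if "z \<in> A" for z
    using h(1)[OF that] last_in_set[of "z # h z"] unfolding P_def e_def links_def by (blast, blast)
  have dis: "P z \<inter> P w = {}" if "z \<in> A" "w \<in> A" "z \<noteq> w" for z w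
    using h(2)[OF that] by (simp only: P_def)
  have "inj_on e A"
    using e dis by (intro inj_onI) (metis IntI empty_iff)
  moreover have "e ` A \<subseteq> B" using e by blast
  ultimately have "bij_betw e A B"
    using fin A(2) B(2) by (metis bij_betw_def card_image card_subset_eq)
  moreover have "P u \<subseteq> V - Z" if "u \<in> A" for u
  proof -
    have "set p \<subseteq> V - Z" if "successively (\<lambda>x y. (x, y) \<in> D) (u # p)" "u \<in> V - Z" for u p
      using that by (induction p arbitrary: u) (auto simp: D_def)
    then show ?thesis using h(1)[OF that] that A(1) unfolding P_def links_def by auto
  qed
  moreover have "reaches E (P u) u (e u)" if "u \<in> A" for u
  proof (rule reaches_successively)
    show "successively E (u # h u)"
      using h(1)[OF that] unfolding links_def by (auto simp: D_def elim!: successively_mono)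
    show "e u \<in> set (u # h u)" unfolding e_def by (rule last_in_set) simp
  qed (simp add: P_def)
  ultimately show ?thesis
    using that[of P e] e dis by (auto simp: P_def disjoint_family_on_def)
qed

section \<open>Small dominating sets\<close>

text \<open>Average the weight dominated by \<open>d\<close>, with \<open>d\<close> itself weighted
  by \<open>w\<close>. Every pair satisfies \<open>g d v + g v d \<ge> 1\<close>, so by symmetry the
  average is at least half of the total weight.\<close>

lemma weighted_dominating_vertex:
  fixes w :: "'a \<Rightarrow> real"
  assumes T: "tournament V E" and S: "finite S" "S \<noteq> {}" "S \<subseteq> V" and w: "\<And>v. v \<in> S \<Longrightarrow> 0 \<le> w v"
  shows "\<exists>d\<in>S. sum w S \<le> 2 * (\<Sum>v | v \<in> S \<and> (v = d \<or> E d v). w v)"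
proof (rule ccontr)
  define g where "g d v = (if v = d \<or> E d v then 1 else 0 :: real)" for d v
  have g: "(\<Sum>v | v \<in> S \<and> (v = d \<or> E d v). w v) = (\<Sum>v\<in>S. w v * g d v)" for d
    using S(1) by (simp add: g_def sum.inter_filter[symmetric] if_distrib cong: if_cong)
  assume "\<not> ?thesis"
  then have small: "2 * (\<Sum>v\<in>S. w v * g d v) < sum w S" if "d \<in> S" for d
    using that unfolding g by force
  have nonneg: "0 \<le> (\<Sum>v\<in>S. w v * g d v)" for d
    using w by (intro sum_nonneg) (auto simp: g_def)
  have pos: "0 < sum w S" 
  proof -
    obtain d where "d \<in> S" using S(2) by blast
    then show ?thesis using small[of d] nonneg[of d] by linarith
  qed
  \<comment> \<open>A vertex of positive weight is what makes the averaged inequality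
    strict.\<close>
  then obtain d0 where d0: "d0 \<in> S" "0 < w d0"
    using sum_nonpos[of S w] by force
  have "(\<Sum>d\<in>S. w d * (2 * (\<Sum>v\<in>S. w v * g d v))) < (\<Sum>d\<in>S. w d * sum w S)"
  proof (rule sum_strict_mono_ex1)
    show "\<forall>d\<in>S. w d * (2 * (\<Sum>v\<in>S. w v * g d v)) \<le> w d * sum w S"
      by (intro ballI mult_left_mono less_imp_le[OF small] w)
    show "\<exists>d\<in>S. w d * (2 * (\<Sum>v\<in>S. w v * g d v)) < w d * sum w S"
      using d0 mult_strict_left_mono[OF small[OF d0(1)] d0(2)] by blast
  qed (rule S)
  also have "(\<Sum>d\<in>S. w d * (2 * (\<Sum>v\<in>S. w v * g d v))) =
      (\<Sum>d\<in>S. \<Sum>v\<in>S. w d * w v * g d v) + (\<Sum>v\<in>S. \<Sum>d\<in>S. w d * w v * g d v)"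
    by (subst (2) sum.swap) (simp add: sum_distrib_left mult_ac flip: sum.distrib)
  also have "\<dots> = (\<Sum>d\<in>S. \<Sum>v\<in>S. w d * w v * (g d v + g v d))"
    by (simp add: algebra_simps flip: sum.distrib)
  finally have "(\<Sum>d\<in>S. \<Sum>v\<in>S. w d * w v * (g d v + g v d)) < (\<Sum>d\<in>S. w d * sum w S)" .
  moreover have "(\<Sum>d\<in>S. \<Sum>v\<in>S. w d * w v * 1) \<le> (\<Sum>d\<in>S. \<Sum>v\<in>S. w d * w v * (g d v + g v d))"
  proof (intro sum_mono mult_left_mono)
    fix d v assume "d \<in> S" "v \<in> S"
    then have "d = v \<or> E d v \<or> E v d" using tournament_edge_cases[OF T] S(3) by blast
    then show "1 \<le> g d v + g v d" by (auto simp: g_def)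
  qed (use w in auto)
  ultimately show False by (simp add: sum_distrib_left)
qed

lemma low_indegree_vertex:
  assumes T: "tournament V E" and S: "finite S" "S \<noteq> {}" "S \<subseteq> V"
  obtains a where "a \<in> S" "2 * card {v\<in>S. E v a} \<le> card S"
proof -
  obtain a where a: "a \<in> S" "real (card S) \<le> 2 * real (card {v\<in>S. v = a \<or> E a v})"
    using weighted_dominating_vertex[OF T S, of "\<lambda>_. 1"] by auto
  have "{v\<in>S. E v a} \<inter> {v\<in>S. v = a \<or> E a v} = {}"
    using tournament_asym[OF T] by blast
  then have "card {v\<in>S. E v a} + card {v\<in>S. v = a \<or> E a v} \<le> card S"
    using S(1) by (subst card_Un_disjoint[symmetric]) (auto intro!: card_mono)
  moreover have "card S \<le> 2 * card {v\<in>S. v = a \<or> E a v}" using a(2) by linarith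
  ultimately show ?thesis using that[OF a(1)] by simp
qed

text \<open>Choose \<open>a\<close> with few in-neighbours in \<open>S\<close> and continue inside
  its in-neighbourhood \<open>N\<close>: whatever \<open>a\<close> misses lies in \<open>N\<close>,
  and \<open>N\<close> has at most half the size. All later choices dominate \<open>a\<close>, so
  the last vertex chosen is the root and reaches each earlier one by an edge.\<close>

lemma rooted_dominating_set:
  assumes T: "tournament V E" and S: "finite S" "S \<noteq> {}" "S \<subseteq> V"
  shows "\<exists>A r. A \<subseteq> S \<and> r \<in> A \<and> card A \<le> Suc c \<and> (\<forall>v\<in>A. reaches E A r v) \<and>
           2 ^ c * card {v\<in>S - A. \<forall>u\<in>A. \<not> E u v} \<le> card S"
  using S
proof (induction c arbitrary: S)
  case 0
  then obtain r where "r \<in> S" by blast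
  then show ?case
    using 0 by (intro exI[of _ "{r}"] exI[of _ r]) (auto intro: card_mono)
next
  case (Suc c)
  obtain a where a: "a \<in> S" "2 * card {v\<in>S. E v a} \<le> card S"
    using low_indegree_vertex[OF T Suc.prems] .
  define N where "N = {v\<in>S. E v a}"
  have dom: "v \<in> N" if "v \<in> S" "v \<noteq> a" "\<not> E a v" for v
    using that tournament_edge_cases[OF T] a(1) Suc.prems(3) by (auto simp: N_def)
  show ?case
  proof (cases "N = {}")
    case True
    then have "{v\<in>S - {a}. \<forall>u\<in>{a}. \<not> E u v} = {}" using dom by auto
    then show ?thesis
      using a by (intro exI[of _ "{a}"] exI[of _ a]) (auto simp del: Diff_iff Collect_empty_eq)
  next
    case False
    have "finite N" "N \<subseteq> V" using Suc.prems by (auto simp: N_def)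
    then obtain A r where A: "A \<subseteq> N" "r \<in> A" "card A \<le> Suc c" "\<forall>v\<in>A. reaches E A r v"
        "2 ^ c * card {v\<in>N - A. \<forall>u\<in>A. \<not> E u v} \<le> card N"
      using Suc.IH[of N] False by blast
    have "card {v\<in>S - insert a A. \<forall>u\<in>insert a A. \<not> E u v} \<le> card {v\<in>N - A. \<forall>u\<in>A. \<not> E u v}"
      using dom \<open>finite N\<close> by (intro card_mono) auto
    then have "2 ^ c * card {v\<in>S - insert a A. \<forall>u\<in>insert a A. \<not> E u v} \<le> card N"
      using A(5) by (meson le_trans mult_le_mono2)
    then have "2 ^ Suc c * card {v\<in>S - insert a A. \<forall>u\<in>insert a A. \<not> E u v} \<le> card S"
      using a(2) by (simp add: N_def)
    moreover have "E r a" using A(1,2) by (auto simp: N_def)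
    moreover have "reaches E (insert a A) r v" if "v \<in> insert a A" for v
      using that A(2,4) \<open>E r a\<close> by (auto intro: reaches_edge reaches_mono)
    moreover have "card (insert a A) \<le> Suc (Suc c)"
      using A(3) finite_subset[OF A(1) \<open>finite N\<close>] by (simp add: card_insert_if)
    moreover have "insert a A \<subseteq> S" using A(1) a(1) by (auto simp: N_def)
    ultimately show ?thesis using A(2) by (intro exI[of _ "insert a A"] exI[of _ r]) auto
  qed
qed

section \<open>Greedy selection and repeated domination\<close>

text \<open>Greedy: \<open>Z0\<close> with all sets chosen so far is again an admissible
  \<open>Z\<close>. The objects \<open>x\<close> are kept apart from their sets \<open>g x\<close>
  because they also carry roots.\<close>

lemma disjoint_selection:
  assumes step: "\<And>Z. finite Z \<Longrightarrow> card Z \<le> card Z0 + N * c \<Longrightarrow> \<exists>x. Q x \<and> finite (g x) \<and> card (g x) \<le> c \<and> g x \<inter> Z = {}"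
    and Z0: "finite Z0"
  shows "\<exists>f. (\<forall>i<N. Q (f i) \<and> finite (g (f i)) \<and> card (g (f i)) \<le> c \<and> g (f i) \<inter> Z0 = {}) \<and>
             disjoint_family_on (\<lambda>i. g (f i)) {..<N}"
  using step
proof (induction N)
  case 0
  then show ?case by (auto simp: disjoint_family_on_def)
next
  case (Suc N)
  have "\<exists>x. Q x \<and> finite (g x) \<and> card (g x) \<le> c \<and> g x \<inter> Z = {}"
    if "finite Z" "card Z \<le> card Z0 + N * c" for Z
    using Suc.prems[OF that(1)] that(2) by simp
  then obtain f where f: "\<forall>i<N. Q (f i) \<and> finite (g (f i)) \<and> card (g (f i)) \<le> c \<and> g (f i) \<inter> Z0 = {}"
      "disjoint_family_on (\<lambda>i. g (f i)) {..<N}"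
    using Suc.IH by blast
  define Z where "Z = Z0 \<union> (\<Union>i<N. g (f i))"
  have "card (\<Union>i<N. g (f i)) \<le> (\<Sum>i<N. card (g (f i)))" by (rule card_UN_le) simp
  also have "\<dots> \<le> N * c" using f(1) sum_bounded_above[of "{..<N}" "\<lambda>i. card (g (f i))" c] by simp
  finally have "card Z \<le> card Z0 + N * c" using card_Un_le[of Z0 "\<Union>i<N. g (f i)"] by (simp add: Z_def)
  moreover have "finite Z" using Z0 f(1) by (auto simp: Z_def)
  ultimately obtain x where x: "Q x" "finite (g x)" "card (g x) \<le> c" "g x \<inter> Z = {}"
    using Suc.prems[of Z] by auto
  show ?case
  proof (intro exI[of _ "f(N := x)"] conjI)
    show "disjoint_family_on (\<lambda>i. g ((f(N := x)) i)) {..<Suc N}"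
      unfolding disjoint_family_on_def
    proof (intro ballI impI)
      fix i j assume ij: "i \<in> {..<Suc N}" "j \<in> {..<Suc N}" "i \<noteq> j"
      have "g (f i) \<inter> g (f j) = {}" if "i < N" "j < N"
        using f(2) ij(3) that by (simp add: disjoint_family_on_def)
      moreover have "g x \<inter> g (f k) = {}" if "k < N" for k using x(4) that by (auto simp: Z_def)
      ultimately show "g ((f(N := x)) i) \<inter> g ((f(N := x)) j) = {}"
        using ij by (auto simp: less_Suc_eq Int_commute)
    qed
  qed (use f(1) x in \<open>auto simp: less_Suc_eq Z_def\<close>)
qed

text \<open>Multiplicative weights: halving the weight of everything dominated by the chosen vertex
  decreases the total weight by a factor of at least \<open>3/4\<close>.\<close>
lemma multiple_domination_weights:
  assumes T: "tournament V E" and X: "finite X" "X \<noteq> {}" "X \<subseteq> V"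
  shows "\<exists>d :: nat \<Rightarrow> 'a. (\<forall>k<s. d k \<in> X) \<and>
           (\<Sum>v\<in>X. (1/2 :: real) ^ card {k. k < s \<and> (v = d k \<or> E (d k) v)}) \<le> card X * (3/4) ^ s"
proof (induction s)
  case 0
  then show ?case by simp
next
  case (Suc s)
  then obtain d where d: "\<forall>k<s. d k \<in> X"
    "(\<Sum>v\<in>X. (1/2 :: real) ^ card {k. k < s \<and> (v = d k \<or> E (d k) v)}) \<le> card X * (3/4) ^ s" by blast
  define w where "w v = (1/2 :: real) ^ card {k. k < s \<and> (v = d k \<or> E (d k) v)}" for v
  obtain x where x: "x \<in> X" "sum w X \<le> 2 * (\<Sum>v | v \<in> X \<and> (v = x \<or> E x v). w v)"
    using weighted_dominating_vertex[OF T X, of w] by (auto simp: w_def)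
  define d' where "d' = d(s := x)"
  have "{k. k < Suc s \<and> (v = d' k \<or> E (d' k) v)} =
      (if v = x \<or> E x v then insert s else id) {k. k < s \<and> (v = d k \<or> E (d k) v)}" for v
    by (auto simp: d'_def less_Suc_eq)
  then have "(1/2 :: real) ^ card {k. k < Suc s \<and> (v = d' k \<or> E (d' k) v)} =
      w v - (if v = x \<or> E x v then w v / 2 else 0)" for v
    by (simp add: w_def)
  then have "(\<Sum>v\<in>X. (1/2 :: real) ^ card {k. k < Suc s \<and> (v = d' k \<or> E (d' k) v)}) =
      sum w X - (\<Sum>v\<in>X. if v = x \<or> E x v then w v / 2 else 0)"
    by (simp add: sum_subtractf)
  also have "(\<Sum>v\<in>X. if v = x \<or> E x v then w v / 2 else 0) = (\<Sum>v | v \<in> X \<and> (v = x \<or> E x v). w v) / 2"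
    using X(1) by (simp add: sum.inter_filter sum_divide_distrib if_distrib[of "\<lambda>x. x / 2"] cong: if_cong)
  also have "sum w X - \<dots> \<le> sum w X * (3/4)" using x(2) by simp
  also have "\<dots> \<le> card X * (3/4) ^ s * (3/4)"
    using d(2) unfolding w_def by (intro mult_right_mono) auto
  finally have "(\<Sum>v\<in>X. (1/2 :: real) ^ card {k. k < Suc s \<and> (v = d' k \<or> E (d' k) v)}) \<le> card X * (3/4) ^ Suc s"
    by (simp add: mult_ac)
  moreover have "\<forall>k<Suc s. d' k \<in> X" using d(1) x(1) by (auto simp: d'_def less_Suc_eq)
  ultimately show ?case by blast
qed

text \<open>After \<open>8 * r\<close> rounds the total weight is at most
  \<open>(2 * (3/4) ^ 8) ^ r\<close>, and \<open>2 * (3/4) ^ 8 < 1/4\<close>. No single vertex then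
  weighs more than \<open>(1/2) ^ (2 * r)\<close>, which means that it was dominated at least
  \<open>2 * r\<close> times.\<close>

lemma multiple_domination:
  assumes T: "tournament V E" and X: "finite X" "X \<noteq> {}" "X \<subseteq> V" "card X \<le> 2 ^ r"
  obtains d :: "nat \<Rightarrow> 'a" where "\<And>k. k < 8 * r \<Longrightarrow> d k \<in> X"
    "\<And>v. v \<in> X \<Longrightarrow> 2 * r \<le> card {k. k < 8 * r \<and> (v = d k \<or> E (d k) v)}"
proof -
  obtain d :: "nat \<Rightarrow> 'a" where d: "\<forall>k<8 * r. d k \<in> X"
    "(\<Sum>v\<in>X. (1/2 :: real) ^ card {k. k < 8 * r \<and> (v = d k \<or> E (d k) v)}) \<le> card X * (3/4) ^ (8 * r)"
    using multiple_domination_weights[OF T X(1-3), of "8 * r"] by blast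
  have "2 * r \<le> card {k. k < 8 * r \<and> (v = d k \<or> E (d k) v)}" (is "_ \<le> ?c v") if v: "v \<in> X" for v
  proof -
    have "(1/2 :: real) ^ ?c v \<le> (\<Sum>v\<in>X. (1/2) ^ ?c v)"
      using v X(1) by (intro member_le_sum) auto
    also note d(2)
    also have "card X * (3/4 :: real) ^ (8 * r) \<le> 2 ^ r * (3/4) ^ (8 * r)"
      using of_nat_mono[OF X(4), where ?'a = real] by (intro mult_right_mono) auto
    also have "\<dots> = (2 * (3/4) ^ 8) ^ r" by (simp only: power_mult power_mult_distrib)
    also have "\<dots> \<le> ((1/2)\<^sup>2) ^ r" by (intro power_mono) (simp_all add: power_divide)
    also have "\<dots> = (1/2) ^ (2 * r)" by (simp only: power_mult)
    finally show ?thesis by (subst (asm) power_decreasing_iff) auto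
  qed
  then show ?thesis using that d(1) by blast
qed

text \<open>The vertices that \<open>a\<close> does not dominate are dominated, many times over, by a short sequence
  of vertices \<open>d k\<close>; minimality of the in-degree of \<open>a\<close> gives every \<open>d k\<close> an in-neighbour that \<open>a\<close>
  dominates. The weight of \<open>Q i\<close> bounds the share of the pairs that deleting \<open>Q i\<close> can destroy.\<close>
lemma robust_reachability:
  assumes T: "tournament V E" and a: "a \<in> V" "\<And>v. v \<in> V \<Longrightarrow> card {u. E u a} \<le> card {u. E u v}"
    and r: "card V \<le> 2 ^ r" "1 \<le> r"
    and Q: "finite I" "disjoint_family_on Q I" "\<And>i. i \<in> I \<Longrightarrow> a \<notin> Q i"
  obtains \<omega> :: "'i \<Rightarrow> real" where "\<And>i. i \<in> I \<Longrightarrow> 0 \<le> \<omega> i" "sum \<omega> I \<le> 2"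
    "\<And>J. J \<subseteq> I \<Longrightarrow> sum \<omega> J < 1 / 4 \<Longrightarrow> \<exists>G\<subseteq>V. card G \<le> 16 * r \<and> (\<forall>i\<in>J. G \<inter> Q i = {}) \<and>
        (\<forall>U v. insert a G \<subseteq> U \<longrightarrow> U \<subseteq> V \<longrightarrow> v \<in> U \<longrightarrow> reaches E U a v)"
proof -
  define X where "X = {u. E u a}"
  have finV: "finite V" and EV: "\<And>u v. E u v \<Longrightarrow> u \<in> V \<and> v \<in> V" and irr: "\<And>v. \<not> E v v"
    using T unfolding tournament_def by blast+
  have X: "X \<subseteq> V" "finite X" using EV finV by (auto simp: X_def intro: finite_subset)
  have dom: "E a v" if "v \<in> V" "v \<noteq> a" "v \<notin> X" for v
    using that tournament_edge_cases[OF T a(1)] by (auto simp: X_def)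
  show ?thesis
  proof (cases "X = {}")
    case True
    have *: "reaches E U a v" if "insert a {} \<subseteq> U" "U \<subseteq> V" "v \<in> U" for U v
      using that dom[of v] True by (cases "v = a") (auto intro: reaches_edge)
    then have "\<exists>G\<subseteq>V. card G \<le> 16 * r \<and> (\<forall>i\<in>J. G \<inter> Q i = {}) \<and>
        (\<forall>U v. insert a G \<subseteq> U \<longrightarrow> U \<subseteq> V \<longrightarrow> v \<in> U \<longrightarrow> reaches E U a v)" for J
      by (intro exI[of _ "{}"] conjI allI impI *) auto
    then show ?thesis by (rule that[of "\<lambda>_. 0", rotated 2]) auto
  next
    case False
    have "card X \<le> 2 ^ r" using card_mono[OF finV X(1)] r(1) by linarith
    from multiple_domination[OF T X(2) False X(1) this] obtain d :: "nat \<Rightarrow> 'a" where d: "\<And>k. k < 8 * r \<Longrightarrow> d k \<in> X"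
      "\<And>v. v \<in> X \<Longrightarrow> 2 * r \<le> card {k. k < 8 * r \<and> (v = d k \<or> E (d k) v)}" by blast
    define Y where "Y k = {u. E u (d k)} - X" for k
    have finY: "finite (Y k)" for k using EV finV by (auto simp: Y_def intro: finite_subset[of _ V])
    \<comment> \<open>Otherwise the in-neighbours of \<open>d k\<close> all lie in \<open>X\<close>
      but omit \<open>d k \<in> X\<close> itself, fewer than \<open>a\<close> has.\<close>
    have Y: "Y k \<noteq> {}" if "k < 8 * r" for k
    proof
      assume "Y k = {}"
      then have "{u. E u (d k)} \<subseteq> X - {d k}" using irr by (auto simp: Y_def)
      then have "card {u. E u (d k)} \<le> card (X - {d k})" using X(2) by (intro card_mono) auto
      also have "\<dots> < card X" using X(2) d(1)[OF that] by (rule card_Diff1_less)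
      also have "\<dots> \<le> card {u. E u (d k)}" using a(2)[of "d k"] d(1)[OF that] X(1) unfolding X_def by blast
      finally show False by simp
    qed
    \<comment> \<open>The harm \<open>Q i\<close> does to index \<open>k\<close>: hitting
      \<open>d k\<close> costs 1, hitting \<open>Y k\<close> costs the share hit. By disjointness of
      the \<open>Q i\<close> each of the two parts sums to at most 1, whence the bound 2.\<close>
    define h where "h k i = (if d k \<in> Q i then 1 else 0 :: real) + card (Y k \<inter> Q i) / card (Y k)" for k i
    define \<omega> where "\<omega> i = (\<Sum>k<8 * r. h k i) / real (8 * r)" for i
    have h0: "0 \<le> h k i" for k i by (simp add: h_def)
    have "(\<Sum>i\<in>I. h k i) \<le> 2" if "k < 8 * r" for k
    proof -
      have "(\<Sum>i\<in>I. if d k \<in> Q i then 1 else 0 :: real) = card {i\<in>I. d k \<in> Q i}"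
        using Q(1) by (simp add: sum.inter_filter[symmetric])
      also have "card {i\<in>I. d k \<in> Q i} \<le> 1"
        using Q(1,2) by (intro card_le_Suc0_iff_eq[THEN iffD2, unfolded One_nat_def[symmetric]])
          (auto simp: disjoint_family_on_def)
      finally have 1: "(\<Sum>i\<in>I. if d k \<in> Q i then 1 else 0 :: real) \<le> 1" by simp
      have "(\<Sum>i\<in>I. card (Y k \<inter> Q i)) = card (\<Union>i\<in>I. Y k \<inter> Q i)"
        using Q(1,2) finY by (intro card_UN_disjoint[symmetric]) (auto simp: disjoint_family_on_def)
      also have "\<dots> \<le> card (Y k)" using finY by (intro card_mono) auto
      finally have "(\<Sum>i\<in>I. card (Y k \<inter> Q i) / card (Y k)) \<le> 1"
        using Y[OF that] finY by (simp add: sum_divide_distrib[symmetric] divide_le_eq card_gt_0_iff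
            flip: of_nat_sum)
      with 1 show ?thesis by (simp add: h_def sum.distrib)
    qed
    then have "(\<Sum>k<8 * r. \<Sum>i\<in>I. h k i) \<le> (\<Sum>k<8 * r. 2)" by (intro sum_mono) simp
    moreover have "sum \<omega> I = (\<Sum>k<8 * r. \<Sum>i\<in>I. h k i) / real (8 * r)"
      unfolding \<omega>_def sum_divide_distrib[symmetric] by (subst sum.swap) simp
    ultimately have "sum \<omega> I \<le> 2" using r(2) by (simp add: divide_le_eq)
    moreover have "0 \<le> \<omega> i" for i by (simp add: \<omega>_def h0 sum_nonneg)
    moreover have "\<exists>G\<subseteq>V. card G \<le> 16 * r \<and> (\<forall>i\<in>J. G \<inter> Q i = {}) \<and>
        (\<forall>U v. insert a G \<subseteq> U \<longrightarrow> U \<subseteq> V \<longrightarrow> v \<in> U \<longrightarrow> reaches E U a v)"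
      if J: "J \<subseteq> I" "sum \<omega> J < 1 / 4" for J
    proof -
      have finJ: "finite J" using J(1) Q(1) finite_subset by blast
      \<comment> \<open>The destroyed indices. Each has total harm at least 1 from \<open>J\<close>,
        so weight below \<open>1 / 4\<close> destroys fewer than \<open>8 * r / 4 = 2 * r\<close> of
        them, less than the multiplicity of domination.\<close>
      define B where "B = {k. k < 8 * r \<and> (d k \<in> (\<Union>i\<in>J. Q i) \<or> Y k \<subseteq> (\<Union>i\<in>J. Q i))}"
      have "1 \<le> (\<Sum>i\<in>J. h k i)" if k: "k \<in> B" for k
      proof (cases "d k \<in> (\<Union>i\<in>J. Q i)")
        case True
        then obtain i where i: "i \<in> J" "d k \<in> Q i" by blast
        then have "1 \<le> h k i" by (simp add: h_def)
        also have "\<dots> \<le> (\<Sum>i\<in>J. h k i)" using i finJ h0 by (intro member_le_sum) auto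
        finally show ?thesis .
      next
        case False
        then have k': "k < 8 * r" "Y k \<subseteq> (\<Union>i\<in>J. Q i)" using k by (auto simp: B_def)
        have "Y k = (\<Union>i\<in>J. Y k \<inter> Q i)" using k' by blast
        then have "card (Y k) = card (\<Union>i\<in>J. Y k \<inter> Q i)" by simp
        also have "\<dots> \<le> (\<Sum>i\<in>J. card (Y k \<inter> Q i))" using finJ by (rule card_UN_le)
        finally have "1 \<le> (\<Sum>i\<in>J. card (Y k \<inter> Q i) / card (Y k))"
          using Y[OF k'(1)] finY by (simp add: sum_divide_distrib[symmetric] le_divide_eq card_gt_0_iff
            flip: of_nat_sum)
        also have "\<dots> \<le> (\<Sum>i\<in>J. h k i)" by (intro sum_mono) (simp add: h_def)
        finally show ?thesis .
      qed
      then have "(\<Sum>k\<in>B. 1) \<le> (\<Sum>k\<in>B. \<Sum>i\<in>J. h k i)" by (intro sum_mono) auto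
      also have "\<dots> \<le> (\<Sum>k<8 * r. \<Sum>i\<in>J. h k i)"
        using h0 by (intro sum_mono2) (auto simp: B_def intro: sum_nonneg)
      also have "\<dots> = sum \<omega> J * real (8 * r)"
        unfolding \<omega>_def sum_divide_distrib[symmetric] using r(2) by (subst sum.swap) simp
      also have "\<dots> < 1 / 4 * real (8 * r)" using J(2) r(2) by (intro mult_strict_right_mono) auto
      finally have B: "card B < 2 * r" by simp
      define y where "y k = (SOME u. u \<in> Y k - (\<Union>i\<in>J. Q i))" for k
      have y: "y k \<in> Y k - (\<Union>i\<in>J. Q i)" if "k < 8 * r" "k \<notin> B" for k
      proof -
        have "\<exists>u. u \<in> Y k - (\<Union>i\<in>J. Q i)" using that by (auto simp: B_def)
        then show ?thesis unfolding y_def by (rule someI_ex)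
      qed
      \<comment> \<open>The reserve \<open>G\<close> holds \<open>d k\<close> and one surviving
        in-neighbour \<open>y k\<close> for each intact index, hence at most
        \<open>2 * (8 * r)\<close> vertices.\<close>
      define K where "K = {..<8 * r} - B"
      define G where "G = d ` K \<union> y ` K"
      have "card K \<le> 8 * r" unfolding K_def by (metis card_Diff_subset_Int card_lessThan diff_le_self finite_Int finite_lessThan)
      then have "card G \<le> 16 * r"
        using card_Un_le[of "d ` K" "y ` K"] card_image_le[of K d] card_image_le[of K y]
        unfolding G_def K_def by fastforce
      moreover have "d k \<in> V \<and> y k \<in> V" if "k \<in> K" for k
        using d(1)[of k] X(1) y[of k] EV[of "y k" "d k"] that by (auto simp: K_def Y_def)
      then have "G \<subseteq> V" by (auto simp: G_def)
      moreover have "d k \<notin> Q i \<and> y k \<notin> Q i" if "k \<in> K" "i \<in> J" for k i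
        using y[of k] that by (auto simp: K_def B_def)
      then have "\<forall>i\<in>J. G \<inter> Q i = {}" by (auto simp: G_def)
      moreover have "reaches E U a v" if U: "insert a G \<subseteq> U" "U \<subseteq> V" "v \<in> U" for U v
      proof (cases "v = a \<or> v \<notin> X")
        case True
        then show ?thesis using dom U by (cases "v = a") (auto intro: reaches_edge)
      next
        case False
        \<comment> \<open>An intact index dominates \<open>v\<close>, and the route is from
          \<open>a\<close> to \<open>y k\<close>, to \<open>d k\<close>, to
          \<open>v\<close>.\<close>
        have "\<not> {k. k < 8 * r \<and> (v = d k \<or> E (d k) v)} \<subseteq> B"
        proof
          assume "{k. k < 8 * r \<and> (v = d k \<or> E (d k) v)} \<subseteq> B"
          moreover have "finite B" by (simp add: B_def)
          ultimately have "card {k. k < 8 * r \<and> (v = d k \<or> E (d k) v)} \<le> card B" by (intro card_mono)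
          then show False using d(2)[of v] False B by simp
        qed
        then obtain k where k: "k \<in> K" "v = d k \<or> E (d k) v" by (auto simp: K_def)
        have ky: "y k \<in> V" "y k \<notin> X" "E (y k) (d k)" "y k \<in> U" "d k \<in> U"
          using y[of k] k(1) EV U(1) by (auto simp: K_def Y_def G_def)
        have "E (d k) a" using d(1)[of k] k(1) by (auto simp: K_def X_def)
        then have "y k \<noteq> a" using ky(3) tournament_asym[OF T] by blast
        then have "reaches E U a (y k)" using dom ky U(1) by (auto intro: reaches_edge)
        also have "reaches E U (y k) (d k)" using ky by (auto intro: reaches_edge)
        also have "reaches E U (d k) v" using k(2) ky U(3) by (auto intro: reaches_edge)
        finally show ?thesis .
      qed
      ultimately show ?thesis by blast
    qed
    ultimately show ?thesis by (intro that)
  qed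
qed

text \<open>Markov's inequality: at most half of the indices exceed twice the bound
  \<open>c / card I\<close> on the mean, and \<open>J\<close> is taken among the others.\<close>

lemma light_subset:
  fixes \<omega> :: "'i \<Rightarrow> real"
  assumes I: "finite I" "2 * m \<le> card I" and \<omega>: "\<And>i. i \<in> I \<Longrightarrow> 0 \<le> \<omega> i" and c: "sum \<omega> I \<le> c" "0 < c"
  obtains J where "J \<subseteq> I" "card J = m" "sum \<omega> J * card I \<le> 2 * c * m"
proof -
  define H where "H = {i\<in>I. 2 * c < \<omega> i * card I}"
  have "2 * c * card H \<le> (\<Sum>i\<in>H. \<omega> i * card I)"
    using sum_bounded_below[of H "2 * c" "\<lambda>i. \<omega> i * card I"] by (force simp: H_def mult_ac)
  also have "\<dots> \<le> (\<Sum>i\<in>I. \<omega> i * card I)" using I(1) \<omega> by (intro sum_mono2) (auto simp: H_def)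
  also have "\<dots> = sum \<omega> I * card I" by (rule sum_distrib_right[symmetric])
  also have "\<dots> \<le> c * card I" using c(1) by (intro mult_right_mono) auto
  finally have "c * (2 * card H) \<le> c * card I" by simp
  then have "2 * card H \<le> card I" using c(2) by (simp only: mult_le_cancel_left_pos of_nat_le_iff)
  moreover have "card (I - H) = card I - card H"
    using I(1) by (intro card_Diff_subset) (auto simp: H_def)
  ultimately have "m \<le> card (I - H)" using I(2) by linarith
  then obtain J where J: "J \<subseteq> I - H" "card J = m" using obtain_subset_with_card_n by metis
  have "sum \<omega> J * card I = (\<Sum>i\<in>J. \<omega> i * card I)" by (rule sum_distrib_right)
  also have "\<dots> \<le> 2 * c * m"
    using sum_bounded_above[of J "\<lambda>i. \<omega> i * card I" "2 * c"] J by (force simp: H_def mult_ac)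
  finally show ?thesis using that J by blast
qed

section \<open>Many disjoint linked pairs of dominating sets\<close>

text \<open>Every vertex on a walk from \<open>r\<close> to \<open>v\<close> reaches
  \<open>v\<close> and thus \<open>r\<close>, so the walk never leaves the component; likewise for
  walks to \<open>r\<close>.\<close>

lemma strongly_connected_component:
  "strongly_connected_on {v\<in>M. reaches E M r v \<and> reaches E M v r} E" (is "strongly_connected_on ?W E")
proof -
  have fwd: "reaches E ?W r v" if "reaches E M r v" "reaches E M v r" for v
    using that(1)[unfolded reaches_def] that(2)
  proof (induction rule: rtranclp_induct)
    case (step y z)
    have y: "reaches E M r y" "reaches E M y z" using step.hyps by (auto simp: reaches_def)
    then have z: "reaches E M r z" by (rule reaches_trans)
    note zr = step.prems
    have "reaches E M y r" using y(2) zr by (rule reaches_trans)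
    then have "reaches E ?W r y" by (rule step.IH)
    also have "reaches E ?W y z"
      using step.hyps(2) y z zr \<open>reaches E M y r\<close> by (auto intro: reaches_edge)
    finally show ?case .
  qed simp
  have bwd: "reaches E ?W v r" if "reaches E M v r" "reaches E M r v" for v
    using that(1)[unfolded reaches_def] that(2)
  proof (induction rule: converse_rtranclp_induct)
    case (step y z)
    have y: "reaches E M y z" "reaches E M z r" using step.hyps by (auto simp: reaches_def)
    then have yr: "reaches E M y r" by (rule reaches_trans)
    note ry = step.prems
    have "reaches E M r z" using ry y(1) by (rule reaches_trans)
    have "reaches E ?W y z"
      using step.hyps(1) y yr ry \<open>reaches E M r z\<close> by (auto intro: reaches_edge)
    also have "reaches E ?W z r" using \<open>reaches E M r z\<close> by (rule step.IH)
    finally show ?case .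
  qed simp
  show ?thesis
    unfolding strongly_connected_on_iff using fwd bwd by (blast intro: reaches_trans)
qed

text \<open>Each \<open>v\<close> in \<open>R\<close> closes a circuit from \<open>ra\<close>
  through \<open>A\<close> to \<open>v\<close>, through \<open>B\<close> to \<open>rb\<close>, and
  along \<open>P\<close> back to \<open>ra\<close>. Parts of \<open>A\<close>, \<open>B\<close> and
  \<open>P\<close> may fail to return, so \<open>W\<close> is the strong component of
  \<open>ra\<close> and not the whole union.\<close>

lemma linked_sets_strongly_connected:
  assumes A: "\<And>v. v \<in> A \<Longrightarrow> reaches E A ra v" and B: "\<And>v. v \<in> B \<Longrightarrow> reaches E B v rb"
    and P: "reaches E P rb ra"
    and R: "\<And>v. v \<in> R \<Longrightarrow> v \<in> A \<or> (\<exists>u\<in>A. E u v)" "\<And>v. v \<in> R \<Longrightarrow> v \<in> B \<or> (\<exists>u\<in>B. E v u)"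
  obtains W where "R \<subseteq> W" "W \<subseteq> B \<union> P \<union> A \<union> R" "strongly_connected_on W E"
proof -
  define M where "M = B \<union> P \<union> A \<union> R"
  have sub: "A \<subseteq> M" "B \<subseteq> M" "P \<subseteq> M" "R \<subseteq> M" by (auto simp: M_def)
  have "reaches E M ra v \<and> reaches E M v ra" if v: "v \<in> R" for v
  proof
    show "reaches E M ra v"
    proof (cases "v \<in> A")
      case True
      then show ?thesis using A sub(1) by (blast intro: reaches_mono)
    next
      case False
      then obtain u where u: "u \<in> A" "E u v" using R(1) v by blast
      have "reaches E M ra u" using A[OF u(1)] sub(1) by (rule reaches_mono)
      also have "reaches E M u v" using u v sub by (intro reaches_edge) auto
      finally show ?thesis .
    qed
    have "reaches E M v rb"
    proof (cases "v \<in> B")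
      case True
      then show ?thesis using B sub(2) by (blast intro: reaches_mono)
    next
      case False
      then obtain u where u: "u \<in> B" "E v u" using R(2) v by blast
      have "reaches E M v u" using u v sub by (intro reaches_edge) auto
      also have "reaches E M u rb" using B[OF u(1)] sub(2) by (rule reaches_mono)
      finally show ?thesis .
    qed
    also have "reaches E M rb ra" using P sub(3) by (rule reaches_mono)
    finally show "reaches E M v ra" .
  qed
  then show ?thesis
    using that[OF _ _ strongly_connected_component[of M E ra]] sub(4) unfolding M_def by blast
qed

text \<open>Deleting fewer than \<open>k\<close> out-neighbours would leave \<open>b\<close> without
  exit while other vertices remain.\<close>

lemma strongly_k_connected_out_degree:
  assumes T: "tournament V E" and conn: "strongly_k_connected k V E" and b: "b \<in> V"
  shows "k \<le> card {v. E b v}"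
proof (rule ccontr)
  assume "\<not> k \<le> card {v. E b v}"
  then have lt: "card {v. E b v} < k" by simp
  have N: "{v. E b v} \<subseteq> V" "b \<notin> {v. E b v}" "finite V" using T unfolding tournament_def by blast+
  have "strongly_connected_on (V - {v. E b v}) E"
    by (intro conn[unfolded strongly_k_connected_def, THEN conjunct2, rule_format] conjI N(1) lt)
  moreover have "{b} \<subseteq> V - {v. E b v}" using b N(2) by blast
  moreover have "card {v. E b v} + 1 < card V"
    using lt conn by (auto simp: strongly_k_connected_def)
  then have "card (V - {v. E b v}) \<noteq> 1" using N by (simp add: card_Diff_subset finite_subset)
  then have "{b} \<noteq> V - {v. E b v}" by (metis is_singletonI is_singleton_altdef)
  ultimately obtain x y where "x \<in> {b}" "y \<in> V - {v. E b v} - {b}" "E x y"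
    using strongly_connected_on_crossing[of "V - {v. E b v}" E "{b}"] by blast
  then show False by auto
qed

text \<open>Each set is built in \<open>V\<close> minus the at most \<open>q\<close> vertices taken
  before; these may all escape domination, which explains the summand
  \<open>2 ^ c * q\<close>.\<close>

lemma dominating_family:
  assumes T: "tournament V E" and Z0: "finite Z0" "card Z0 + N * Suc c \<le> q" "q < card V"
  obtains A r where "\<And>i. i < N \<Longrightarrow> A i \<subseteq> V" "\<And>i. i < N \<Longrightarrow> r i \<in> A i" "\<And>i. i < N \<Longrightarrow> card (A i) \<le> Suc c"
    "\<And>i v. i < N \<Longrightarrow> v \<in> A i \<Longrightarrow> reaches E (A i) (r i) v" "\<And>i. i < N \<Longrightarrow> A i \<inter> Z0 = {}"
    "\<And>i. i < N \<Longrightarrow> 2 ^ c * card {v\<in>V - A i. \<forall>u\<in>A i. \<not> E u v} \<le> card V + 2 ^ c * q"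
    "disjoint_family_on A {..<N}"
proof -
  have finV: "finite V" using T by (simp add: tournament_def)
  define Q where "Q x \<longleftrightarrow> fst x \<subseteq> V \<and> snd x \<in> fst x \<and> (\<forall>v\<in>fst x. reaches E (fst x) (snd x) v) \<and>
      2 ^ c * card {v\<in>V - fst x. \<forall>u\<in>fst x. \<not> E u v} \<le> card V + 2 ^ c * q" for x :: "'a set \<times> 'a"
  have "\<exists>x. Q x \<and> finite (fst x) \<and> card (fst x) \<le> Suc c \<and> fst x \<inter> Z = {}"
    if Z: "finite Z" "card Z \<le> card Z0 + N * Suc c" for Z
  proof -
    have Zq: "card Z \<le> q" using Z(2) Z0(2) by linarith
    then have "\<not> V \<subseteq> Z" using card_mono[OF Z(1), of V] Z0(3) by auto
    then have "V - Z \<noteq> {}" "V - Z \<subseteq> V" "finite (V - Z)" using finV by auto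
    from rooted_dominating_set[OF T this(3,1,2), of c]
    obtain A r where A: "A \<subseteq> V - Z" "r \<in> A" "card A \<le> Suc c" "\<forall>v\<in>A. reaches E A r v"
      "2 ^ c * card {v\<in>V - Z - A. \<forall>u\<in>A. \<not> E u v} \<le> card (V - Z)" by blast
    have "card {v\<in>V - A. \<forall>u\<in>A. \<not> E u v} \<le> card ({v\<in>V - Z - A. \<forall>u\<in>A. \<not> E u v} \<union> Z)"
      using finV Z(1) by (intro card_mono) auto
    also have "\<dots> \<le> card {v\<in>V - Z - A. \<forall>u\<in>A. \<not> E u v} + q"
      using Zq card_Un_le le_trans add_le_mono1 add_left_mono by (metis (no_types, lifting))
    finally have "2 ^ c * card {v\<in>V - A. \<forall>u\<in>A. \<not> E u v} \<le>
        2 ^ c * (card {v\<in>V - Z - A. \<forall>u\<in>A. \<not> E u v} + q)" by (rule mult_le_mono2)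
    also have "\<dots> \<le> card V + 2 ^ c * q"
      using A(5) card_mono[OF finV, of "V - Z"] by (simp add: distrib_left)
    finally have "Q (A, r)" using A by (auto simp: Q_def)
    moreover have "finite A" using A(1) finV by (auto intro: finite_subset)
    ultimately show ?thesis using A(1,3) by (intro exI[of _ "(A, r)"]) auto
  qed
  from disjoint_selection[of Z0 N "Suc c" Q fst, OF this Z0(1)]
  obtain f where f: "\<forall>i<N. Q (f i) \<and> finite (fst (f i)) \<and> card (fst (f i)) \<le> Suc c \<and> fst (f i) \<inter> Z0 = {}"
    "disjoint_family_on (\<lambda>i. fst (f i)) {..<N}" by blast
  show ?thesis
    by (rule that[of "\<lambda>i. fst (f i)" "\<lambda>i. snd (f i)"]) (use f in \<open>auto simp: Q_def\<close>)
qed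

lemma exists_small_member:
  assumes "finite V" "finite U" "U \<noteq> {}" "\<And>u. u \<in> U \<Longrightarrow> P u \<subseteq> V" "disjoint_family_on P U"
  obtains u where "u \<in> U" "card U * card (P u) \<le> card V"
proof (rule ccontr)
  assume "\<not> thesis"
  then have gt: "card V < card U * card (P u)" if "u \<in> U" for u
    using that \<open>\<And>u. u \<in> U \<Longrightarrow> card U * card (P u) \<le> card V \<Longrightarrow> thesis\<close> by (meson not_le)
  have "(\<Sum>u\<in>U. card V) < (\<Sum>u\<in>U. card U * card (P u))"
    using assms(2,3) gt by (intro sum_strict_mono) auto
  also have "\<dots> = card U * card (\<Union>u\<in>U. P u)"
    using assms finite_subset[OF assms(4) assms(1)]
    by (subst card_UN_disjoint) (auto simp: sum_distrib_left disjoint_family_on_def)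
  also have "\<dots> \<le> card U * card V"
    using assms(1,4) by (intro mult_le_mono2 card_mono) auto
  finally show False by simp
qed

text \<open>\<open>Q i\<close> consists of an absorbing pair of dominating sets and a path linking them; \<open>X i\<close> collects the few
  vertices that it cannot absorb. The set \<open>H\<close> is built from a short path leaving \<open>b\<close> and a short path
  entering \<open>a\<close>. If the former ends in the dominating set of a pair and the latter starts in another one,
  then any vertex outside \<open>X0\<close> connects the two.\<close>
lemma linked_dominating_sets:
  assumes T: "tournament V E" and t: "2 \<le> t"
    and conn: "strongly_k_connected k V E" and k: "10 ^ 10 * t ^ 4 \<le> k" and ab: "a \<in> V" "b \<in> V"
  obtains I :: "nat set" and Q X :: "nat \<Rightarrow> 'a set" and H X0 :: "'a set"
  where "finite I" "80 * t\<^sup>2 \<le> card I" "\<And>i. i \<in> I \<Longrightarrow> Q i \<subseteq> V" "disjoint_family_on Q I"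
    "\<And>i. i \<in> I \<Longrightarrow> finite (X i)" "\<And>i. i \<in> I \<Longrightarrow> 16 * t * card (X i) \<le> card V"
    "\<And>i R. i \<in> I \<Longrightarrow> R \<subseteq> V - X i \<Longrightarrow> \<exists>W. R \<subseteq> W \<and> W \<subseteq> Q i \<union> R \<and> strongly_connected_on W E"
    "H \<subseteq> V" "a \<in> H" "b \<in> H" "\<And>i. i \<in> I \<Longrightarrow> Q i \<inter> H = {}" "4 * t * card H \<le> card V"
    "finite X0" "16 * t * card X0 \<le> card V"
    "\<And>U. H \<subseteq> U \<Longrightarrow> U \<subseteq> V \<Longrightarrow> \<not> U \<subseteq> X0 \<Longrightarrow> reaches E U b a"
proof -
  have finV: "finite V" using T by (simp add: tournament_def)
  have EV: "\<And>u v. E u v \<Longrightarrow> u \<in> V \<and> v \<in> V" using T unfolding tournament_def by blast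
  define n where "n = card V"
  have kn: "k < n" using conn by (simp add: strongly_k_connected_def n_def)
  \<comment> \<open>The \<open>16 * t\<close> surplus pairs make up for the paths that will end at
    in-neighbours of \<open>a\<close>. The number \<open>q\<close> bounds all vertices in the
    \<open>2 * N\<close> dominating sets together with \<open>a\<close> and
    \<open>b\<close>.\<close>
  define N where "N = 80 * t\<^sup>2 + 16 * t"
  define q where "q = 800 * t ^ 3"
  have k10: "10000000000 * t ^ 4 \<le> k" using k by simp
  have t12: "2 * t \<le> t\<^sup>2" using t by (simp add: power2_eq_square)
  have t23: "2 * t\<^sup>2 \<le> t ^ 3" using t by (simp add: power2_eq_square power3_eq_cube)
  have t34: "2 * t ^ 3 \<le> t ^ 4" using mult_le_mono1[OF t, of "t ^ 3"] by (simp add: power3_eq_cube power4_eq_xxxx)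
  have "N * (t + 7) = 80 * t ^ 3 + 576 * t\<^sup>2 + 112 * t"
    by (simp add: N_def algebra_simps power2_eq_square power3_eq_cube)
  then have Nq: "2 + 2 * (N * (t + 7)) \<le> q" unfolding q_def using t t12 t23 by linarith
  have qk: "q + N + 16 * t \<le> k" unfolding q_def N_def using k10 t t12 t23 t34 by linarith
  \<comment> \<open>Here \<open>x\<close> counts the vertices missed by one dominating set. The
    exponent \<open>t + 6\<close> is chosen for \<open>2 ^ (t + 6) \<ge> 64 * t\<close>, and the
    contribution \<open>64 * t * q = 51200 * t ^ 4\<close> is far below
    \<open>k < n\<close>.\<close>
  have small: "32 * t * x \<le> n" if "2 ^ (t + 6) * x \<le> n + 2 ^ (t + 6) * q" for x
  proof -
    have "t \<le> 2 ^ t" by (simp add: less_imp_le)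
    then have pow: "64 * t \<le> 2 ^ (t + 6)" by (simp add: power_add)
    have tq: "51200 * t ^ 4 = 64 * t * q" by (simp add: q_def power3_eq_cube power4_eq_xxxx)
    have "2 ^ (t + 6) * (x - q) \<le> n" using that by (simp add: diff_mult_distrib2)
    then have "64 * t * (x - q) \<le> n" using mult_le_mono1[OF pow] le_trans by blast
    then have "64 * t * x \<le> n + 64 * t * q" by (simp add: diff_mult_distrib2)
    then show ?thesis using tq k10 kn by linarith
  qed
  have cab: "card {a, b} \<le> 2" by (simp add: card_insert_if)
  have qn: "q < card V" using qk kn by (simp add: n_def)
  have suc: "Suc (t + 6) = t + 7" by simp
  have "card {a, b} + N * Suc (t + 6) \<le> q" unfolding suc using cab Nq by linarith
  from dominating_family[OF T _ this qn, unfolded suc n_def[symmetric]] obtain A ra where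
    A: "\<And>i. i < N \<Longrightarrow> A i \<subseteq> V" "\<And>i. i < N \<Longrightarrow> ra i \<in> A i" "\<And>i. i < N \<Longrightarrow> card (A i) \<le> t + 7"
      "\<And>i v. i < N \<Longrightarrow> v \<in> A i \<Longrightarrow> reaches E (A i) (ra i) v" "\<And>i. i < N \<Longrightarrow> A i \<inter> {a, b} = {}"
      "\<And>i. i < N \<Longrightarrow> 2 ^ (t + 6) * card {v\<in>V - A i. \<forall>u\<in>A i. \<not> E u v} \<le> n + 2 ^ (t + 6) * q"
      "disjoint_family_on A {..<N}"
    by blast
  have finA: "finite (A i)" if "i < N" for i using A(1)[OF that] finV by (rule finite_subset)
  define Z1 where "Z1 = {a, b} \<union> (\<Union>i<N. A i)"
  have cA: "card (\<Union>i<N. A i) \<le> N * (t + 7)"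
    using card_UN_le[of "{..<N}" A] sum_bounded_above[of "{..<N}" "\<lambda>i. card (A i)" "t + 7"] A(3) by force
  have "card Z1 + N * (t + 7) \<le> q"
    using card_Un_le[of "{a, b}" "\<Union>i<N. A i"] cA cab Nq unfolding Z1_def by linarith
  moreover have "finite Z1" using finA by (auto simp: Z1_def)
  ultimately obtain B rb where
    B: "\<And>i. i < N \<Longrightarrow> B i \<subseteq> V" "\<And>i. i < N \<Longrightarrow> rb i \<in> B i" "\<And>i. i < N \<Longrightarrow> card (B i) \<le> t + 7"
      "\<And>i v. i < N \<Longrightarrow> v \<in> B i \<Longrightarrow> reaches E (B i) v (rb i)" "\<And>i. i < N \<Longrightarrow> B i \<inter> Z1 = {}"
      "\<And>i. i < N \<Longrightarrow> 2 ^ (t + 6) * card {v\<in>V - B i. \<forall>u\<in>B i. \<not> E v u} \<le> n + 2 ^ (t + 6) * q"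
      "disjoint_family_on B {..<N}"
    using dominating_family[OF tournament_reverse[OF T], of Z1 N "t + 6" q,
        OF _ _ qn, unfolded suc n_def[symmetric] reaches_reverse[of E]] by blast
  have finB: "finite (B i)" if "i < N" for i using B(1)[OF that] finV by (rule finite_subset)
  have AB: "A i \<inter> B j = {}" if "i < N" "j < N" for i j
    using B(5)[OF that(2)] that(1) by (auto simp: Z1_def)
  have abB: "a \<notin> B i" "b \<notin> B i" if "i < N" for i using B(5)[OF that] by (auto simp: Z1_def)
  have abA: "a \<notin> A i" "b \<notin> A i" if "i < N" for i using A(5)[OF that] by auto
  have Adis: "i = j" if "i < N" "j < N" "x \<in> A i" "x \<in> A j" for i j x
    using A(7) that by (auto simp: disjoint_family_on_def)
  have Bdis: "i = j" if "i < N" "j < N" "x \<in> B i" "x \<in> B j" for i j x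
    using B(7) that by (auto simp: disjoint_family_on_def)
  define XA where "XA i = {v\<in>V - A i. \<forall>u\<in>A i. \<not> E u v}" for i
  define XB where "XB i = {v\<in>V - B i. \<forall>u\<in>B i. \<not> E v u}" for i
  have cX: "16 * t * card (XA i \<union> XB j) \<le> n" if "i < N" "j < N" for i j
  proof -
    have "16 * t * card (XA i \<union> XB j) \<le> 16 * t * (card (XA i) + card (XB j))"
      by (intro mult_le_mono2 card_Un_le)
    then show ?thesis using small[OF A(6)[OF that(1)]] small[OF B(6)[OF that(2)]]
      unfolding XA_def XB_def distrib_left by linarith
  qed
  define Z2 where "Z2 = Z1 \<union> (\<Union>i<N. B i)"
  have cB: "card (\<Union>i<N. B i) \<le> N * (t + 7)"
    using card_UN_le[of "{..<N}" B] sum_bounded_above[of "{..<N}" "\<lambda>i. card (B i)" "t + 7"] B(3) by force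
  have finZ2: "finite Z2" using finA finB by (auto simp: Z2_def Z1_def)
  have cZ2: "card Z2 \<le> q"
    using card_Un_le[of "{a, b}" "\<Union>i<N. A i"] card_Un_le[of Z1 "\<Union>i<N. B i"] cA cB cab Nq
    unfolding Z1_def Z2_def by linarith
  have fan: "\<exists>F\<subseteq>S - Z2. card F = 16 * t" if "k \<le> card S" for S
  proof -
    have "16 * t \<le> card S - card Z2" using that cZ2 qk by linarith
    also have "\<dots> \<le> card (S - Z2)" by (rule diff_card_le_card_Diff[OF finZ2])
    finally show ?thesis using obtain_subset_with_card_n by metis
  qed
  \<comment> \<open>With \<open>16 * t\<close> disjoint paths starting in \<open>Fp\<close>, one has
    at most \<open>n / (16 * t)\<close> vertices; \<open>Fm\<close> plays the same part for path
    ends.\<close>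
  obtain Fp where Fp: "Fp \<subseteq> {v. E b v} - Z2" "card Fp = 16 * t"
    using fan[OF strongly_k_connected_out_degree[OF T conn ab(2)]] by blast
  obtain Fm where Fm: "Fm \<subseteq> {v. E v a} - Z2" "card Fm = 16 * t"
    using fan[OF strongly_k_connected_out_degree[OF tournament_reverse[OF T] _ ab(1)]]
      conn strongly_k_connected_reverse[of k V E] by blast
  have "Fp \<subseteq> V" "Fm \<subseteq> V" using Fp Fm EV by blast+
  then have FV: "Fp \<subseteq> V" "Fm \<subseteq> V" "finite Fp" "finite Fm" using finV by (auto intro: finite_subset)
  have injA: "inj_on ra {..<N}" using A(2) Adis by (metis inj_onI lessThan_iff)
  have injB: "inj_on rb {..<N}" using B(2) Bdis by (metis inj_onI lessThan_iff)
  have raZ: "ra i \<in> Z2" "rb i \<in> Z2" if "i < N" for i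
    using A(2)[OF that] B(2)[OF that] that by (auto simp: Z1_def Z2_def)
  \<comment> \<open>The paths may touch the dominating sets only in their roots, and they avoid
    \<open>a\<close> and \<open>b\<close>. Which start is linked to which end is not prescribed;
    this causes the case distinctions below.\<close>
  define Z where "Z = Z2 - ra ` {..<N} - rb ` {..<N}"
  define Up where "Up = Fp \<union> rb ` {..<N}"
  define Um where "Um = Fm \<union> ra ` {..<N}"
  have cU: "card Up = 16 * t + N" "card Um = 16 * t + N"
    unfolding Up_def Um_def using FV Fp Fm raZ injA injB
    by (subst card_Un_disjoint; auto simp: card_image)+
  have Z2V: "Z2 \<subseteq> V" using ab A(1) B(1) by (auto simp: Z2_def Z1_def)
  have "Z \<subseteq> V" using Z2V by (auto simp: Z_def)
  moreover have "card Z + (16 * t + N) \<le> k"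
  proof -
    have "card Z \<le> card Z2" by (intro card_mono finZ2) (auto simp: Z_def)
    then show ?thesis using cZ2 qk by linarith
  qed
  moreover have "Up \<subseteq> V - Z" "Um \<subseteq> V - Z"
    using FV Fp Fm raZ Z2V by (auto simp: Up_def Um_def Z_def)
  ultimately obtain P e where P: "\<And>u. u \<in> Up \<Longrightarrow> P u \<subseteq> V - Z" "\<And>u. u \<in> Up \<Longrightarrow> u \<in> P u"
      "\<And>u. u \<in> Up \<Longrightarrow> e u \<in> P u" "\<And>u. u \<in> Up \<Longrightarrow> reaches E (P u) u (e u)"
      "disjoint_family_on P Up" "bij_betw e Up Um"
    using strongly_k_connected_linkage[OF T conn _ _ _ cU(1) _ cU(2), of Z] by metis
  have Pdis: "u = v" if "u \<in> Up" "v \<in> Up" "x \<in> P u" "x \<in> P v" for u v x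
    using P(5) that by (auto simp: disjoint_family_on_def)
  have rbU: "rb i \<in> Up" if "i < N" for i using that by (auto simp: Up_def)
  \<comment> \<open>The only vertex of \<open>A j\<close> open to paths is \<open>ra j\<close>, and
    by disjointness it lies just on the path that ends there.\<close>
  have PA: "e u = ra j" if asm: "u \<in> Up" "j < N" "x \<in> P u" "x \<in> A j" for u j x
  proof -
    have "x \<in> Z2" "x \<notin> Z" using asm P(1) by (auto simp: Z2_def Z1_def)
    then consider i where "i < N" "x = ra i" | i where "i < N" "x = rb i" by (auto simp: Z_def)
    then have "x = ra j" using A(2) B(2) Adis[of _ j] AB asm by cases blast+
    moreover have "ra j \<in> e ` Up"
      using bij_betw_imp_surj_on[OF P(6)] asm(2) by (simp add: Um_def)
    then obtain v where "v \<in> Up" "e v = ra j" by (metis imageE)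
    ultimately show ?thesis using Pdis[OF asm(1) _ asm(3)] P(3) by metis
  qed
  have PB: "u = rb j" if "u \<in> Up" "j < N" "x \<in> P u" "x \<in> B j" for u j x
  proof -
    have "x \<in> Z2" "x \<notin> Z" using that P(1) by (auto simp: Z2_def Z1_def)
    then consider i where "i < N" "x = ra i" | i where "i < N" "x = rb i" by (auto simp: Z_def)
    then have "x = rb j" using A(2) B(2) Bdis[of _ j] AB that by cases blast+
    then show ?thesis using Pdis[OF that(1) rbU[OF that(2)] that(3)] P(2) rbU[OF that(2)] by metis
  qed
  have abP: "a \<notin> P u" "b \<notin> P u" if "u \<in> Up" for u
  proof -
    have "a \<notin> ra ` {..<N}" "a \<notin> rb ` {..<N}" "b \<notin> ra ` {..<N}" "b \<notin> rb ` {..<N}"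
      using A(2) B(2) abA abB by (metis imageE lessThan_iff)+
    then have "a \<in> Z" "b \<in> Z" by (auto simp: Z_def Z2_def Z1_def)
    then show "a \<notin> P u" "b \<notin> P u" using P(1)[OF that] by auto
  qed
  have einj: "u = v" if "u \<in> Up" "v \<in> Up" "e u = e v" for u v
    using P(6) that by (auto simp: bij_betw_def inj_on_def)
  have eUm: "e u \<in> Um" if "u \<in> Up" for u using P(6) that by (auto simp: bij_betw_def)
  have FmA: "ra j \<notin> Fm" if "j < N" for j using Fm(1) raZ[OF that] by auto
  have FpB: "rb j \<notin> Fp" if "j < N" for j using Fp(1) raZ[OF that] by auto
  \<comment> \<open>Keep the paths from a root \<open>rb i\<close> to some root
    \<open>ra (\<tau> i)\<close>; at most \<open>card Fm = 16 * t\<close> are lost. A pair thus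
    consists of \<open>B i\<close> and \<open>A (\<tau> i)\<close> with possibly different
    indices.\<close>
  define I where "I = {i. i < N \<and> e (rb i) \<notin> Fm}"
  have "\<exists>j. j < N \<and> e (rb i) = ra j" if "i \<in> I" for i
    using eUm[OF rbU[of i]] that by (auto simp: I_def Um_def)
  then obtain \<tau> where \<tau>: "\<And>i. i \<in> I \<Longrightarrow> \<tau> i < N \<and> e (rb i) = ra (\<tau> i)" by metis
  have IN: "i < N" if "i \<in> I" for i using that by (simp add: I_def)
  define Q where "Q i = B i \<union> P (rb i) \<union> A (\<tau> i)" for i
  have "inj_on (e \<circ> rb) ({..<N} - I)"
    using injB einj rbU by (auto simp: inj_on_def)
  then have "card ({..<N} - I) \<le> card Fm"
    by (rule card_inj_on_le) (auto simp: I_def FV)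
  moreover have "card ({..<N} - I) = N - card I"
    using IN by (subst card_Diff_subset) (auto simp: I_def)
  ultimately have cI: "80 * t\<^sup>2 \<le> card I" using Fm(2) by (simp add: N_def)
  have \<tau>inj: "i = j" if "i \<in> I" "j \<in> I" "\<tau> i = \<tau> j" for i j
    using einj[OF rbU rbU] inj_onD[OF injB] \<tau> that IN by (metis lessThan_iff)
  have Qdis: "disjoint_family_on Q I"
    unfolding disjoint_family_on_def
  proof (intro ballI impI)
    fix i j assume ij: "i \<in> I" "j \<in> I" "i \<noteq> j"
    have rb: "rb i \<noteq> rb j" using inj_onD[OF injB] ij IN by (metis lessThan_iff)
    show "Q i \<inter> Q j = {}"
    proof (rule ccontr)
      assume "Q i \<inter> Q j \<noteq> {}"
      then obtain x where "x \<in> Q i" "x \<in> Q j" by blast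
      moreover have "x \<notin> B i \<or> x \<notin> B j" "x \<notin> A (\<tau> i) \<or> x \<notin> A (\<tau> j)"
        using Bdis Adis ij IN \<tau> \<tau>inj by metis+
      moreover have "x \<notin> B i \<or> x \<notin> A (\<tau> j)" "x \<notin> A (\<tau> i) \<or> x \<notin> B j"
        using AB ij IN \<tau> by blast+
      moreover have "x \<notin> P (rb i) \<or> x \<notin> P (rb j)" using Pdis rbU ij IN rb by metis
      moreover have "x \<notin> P (rb i) \<or> x \<notin> B j" "x \<notin> P (rb j) \<or> x \<notin> B i"
        using PB rbU ij IN rb by metis+
      moreover have "x \<notin> P (rb i) \<or> x \<notin> A (\<tau> j)" "x \<notin> P (rb j) \<or> x \<notin> A (\<tau> i)"
        using PA[OF rbU] \<tau> einj rbU ij IN rb by metis+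
      ultimately show False unfolding Q_def by blast
    qed
  qed
  have QV: "Q i \<subseteq> V" if "i \<in> I" for i
    using A(1) B(1) P(1)[OF rbU] \<tau>[OF that] IN[OF that] unfolding Q_def by blast
  have absorb: "\<exists>W. R \<subseteq> W \<and> W \<subseteq> Q i \<union> R \<and> strongly_connected_on W E"
    if i: "i \<in> I" and R: "R \<subseteq> V - (XA (\<tau> i) \<union> XB i)" for i R
  proof -
    have link: "reaches E (P (rb i)) (rb i) (ra (\<tau> i))" using P(4)[OF rbU[OF IN[OF i]]] \<tau>[OF i] by simp
    have "v \<in> A (\<tau> i) \<or> (\<exists>u\<in>A (\<tau> i). E u v)" "v \<in> B i \<or> (\<exists>u\<in>B i. E v u)" if "v \<in> R" for v
      using that R by (auto simp: XA_def XB_def)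
    from linked_sets_strongly_connected[OF A(4)[OF conjunct1[OF \<tau>[OF i]]] B(4)[OF IN[OF i]] link this]
    obtain W where "R \<subseteq> W" "W \<subseteq> B i \<union> P (rb i) \<union> A (\<tau> i) \<union> R" "strongly_connected_on W E" .
    then show ?thesis unfolding Q_def by blast
  qed
  define Fm' where "Fm' = {u\<in>Up. e u \<in> Fm}"
  have "bij_betw e Fm' Fm"
    using P(6) unfolding bij_betw_def Fm'_def Um_def by (auto simp: inj_on_def)
  then have cFm': "card Fm' = 16 * t" using Fm(2) bij_betw_same_card by metis
  have FpU: "Fp \<subseteq> Up" "Fm' \<subseteq> Up" by (auto simp: Up_def Fm'_def)
  have short: "\<exists>u\<in>F. 16 * t * card (P u) \<le> n" if "F \<subseteq> Up" "card F = 16 * t" for F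
  proof -
    have "F \<noteq> {}" "finite F" using that(2) t by (auto intro: card_ge_0_finite)
    moreover have "disjoint_family_on P F" using P(5) that(1) by (rule disjoint_family_on_mono[rotated])
    moreover have "\<And>u. u \<in> F \<Longrightarrow> P u \<subseteq> V" using P(1) that(1) by blast
    ultimately obtain u where "u \<in> F" "card F * card (P u) \<le> card V"
      using exists_small_member[OF finV, of F P] by blast
    then show ?thesis using that(2) by (auto simp: n_def)
  qed
  obtain u1 where u1: "u1 \<in> Fp" "16 * t * card (P u1) \<le> n" using short[OF FpU(1) Fp(2)] by blast
  obtain u2 where u2: "u2 \<in> Fm'" "16 * t * card (P u2) \<le> n" using short[OF FpU(2) cFm'] by blast
  have u12: "u1 \<in> Up" "u2 \<in> Up" "E b u1" "E (e u2) a" "e u2 \<in> Fm"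
    using u1 u2 Fp(1) Fm(1) FpU by (auto simp: Fm'_def)
  have rbi: "rb i \<noteq> u1" "rb i \<noteq> u2" if "i \<in> I" for i
    using FpB[OF IN[OF that]] u1(1) that u12(5) unfolding I_def by blast+
  have QP: "Q i \<inter> P u = {}" if "i \<in> I" "u \<in> Up" "rb i \<noteq> u" for i u
  proof (rule ccontr)
    assume "Q i \<inter> P u \<noteq> {}"
    then obtain x where x: "x \<in> Q i" "x \<in> P u" by blast
    then consider "x \<in> B i" | "x \<in> P (rb i)" | "x \<in> A (\<tau> i)" by (auto simp: Q_def)
    then show False
    proof cases
      case 1
      then show False using PB[OF that(2) IN[OF that(1)] x(2)] that(3) by blast
    next
      case 2
      then show False using Pdis[OF that(2) rbU[OF IN[OF that(1)]] x(2)] that(3) by blast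
    next
      case 3
      then have "e u = e (rb i)" using PA[OF that(2) _ x(2)] \<tau>[OF that(1)] by simp
      then show False using einj[OF that(2) rbU[OF IN[OF that(1)]]] that(3) by blast
    qed
  qed
  have Qab: "a \<notin> Q i" "b \<notin> Q i" if "i \<in> I" for i
    using abA abB abP rbU IN[OF that] \<tau>[OF that] by (auto simp: Q_def)
  have nt: "16 * t * (2 * t + 16) \<le> n"
  proof -
    have "16 * t * (2 * t + 16) = 32 * t\<^sup>2 + 256 * t" by (simp add: algebra_simps power2_eq_square)
    then show ?thesis using k10 kn t t12 t23 t34 by linarith
  qed
  have PV: "P u \<subseteq> V" if "u \<in> Up" for u using P(1)[OF that] by blast
  have HX: "\<exists>H X0. H \<subseteq> V \<and> a \<in> H \<and> b \<in> H \<and> (\<forall>i\<in>I. Q i \<inter> H = {}) \<and> 4 * t * card H \<le> n \<and>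
      finite X0 \<and> 16 * t * card X0 \<le> n \<and>
      (\<forall>U. H \<subseteq> U \<longrightarrow> U \<subseteq> V \<longrightarrow> \<not> U \<subseteq> X0 \<longrightarrow> reaches E U b a)"
  \<comment> \<open>If a short path runs from an out-neighbour of \<open>b\<close> to an
    in-neighbour of \<open>a\<close>, it connects them outright and \<open>X0\<close> is
    empty.\<close>
  proof (cases "\<exists>u\<in>{u1, u2}. u \<in> Fp \<and> e u \<in> Fm")
    case True
    then obtain u where u: "u \<in> {u1, u2}" "E b u" "E (e u) a" using Fp(1) Fm(1) by blast
    then have u': "u \<in> Up" "16 * t * card (P u) \<le> n" "\<And>i. i \<in> I \<Longrightarrow> rb i \<noteq> u"
      using u12 u1(2) u2(2) rbi by auto
    define H where "H = {a, b} \<union> P u"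
    have "card H \<le> 2 + card (P u)" using card_Un_le[of "{a, b}" "P u"] cab by (simp add: H_def)
    then have "16 * t * card H \<le> 16 * t * (2 + card (P u))" by (rule mult_le_mono2)
    then have "4 * t * card H \<le> n" using u'(2) nt by (simp add: distrib_left)
    moreover have "\<forall>i\<in>I. Q i \<inter> H = {}" using QP[OF _ u'(1,3)] Qab by (auto simp: H_def)
    moreover have "reaches E U b a" if "H \<subseteq> U" for U
    proof -
      have "reaches E U b u" using that u(2) P(2)[OF u'(1)] by (intro reaches_edge) (auto simp: H_def)
      also have "reaches E U u (e u)" using P(4)[OF u'(1)] that by (elim reaches_mono) (auto simp: H_def)
      also have "reaches E U (e u) a" using that u(3) P(3)[OF u'(1)] by (intro reaches_edge) (auto simp: H_def)
      finally show ?thesis .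
    qed
    moreover have "H \<subseteq> V" "a \<in> H" "b \<in> H" using PV[OF u'(1)] ab by (auto simp: H_def)
    ultimately show ?thesis by (intro exI[of _ H] exI[of _ "{}"]) simp
  next
    case False
    then have "e u1 \<notin> Fm" "u2 \<notin> Fp" using u1(1) u12(5) by auto
    then obtain i j where ij: "i < N" "j < N" "u2 = rb i" "e u1 = ra j"
      using eUm[OF u12(1)] u12(2) by (auto simp: Up_def Um_def)
    \<comment> \<open>The route runs from \<open>b\<close> along \<open>P u1\<close> to
      \<open>ra j\<close>, through \<open>A j\<close> to an arbitrary unexceptional vertex, then
      through \<open>B i\<close> to \<open>rb i\<close> and along \<open>P u2\<close> to
      \<open>a\<close>.\<close>
    define H where "H = {a, b} \<union> P u1 \<union> P u2 \<union> A j \<union> B i"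
    have sub: "a \<in> H" "b \<in> H" "P u1 \<subseteq> H" "P u2 \<subseteq> H" "A j \<subseteq> H" "B i \<subseteq> H" by (auto simp: H_def)
    have "card H \<le> 2 + card (P u1) + card (P u2) + (t + 7) + (t + 7)"
      unfolding H_def using cab A(3)[OF ij(2)] B(3)[OF ij(1)]
      by (intro order_trans[OF card_Un_le] add_mono) auto
    then have "16 * t * card H \<le> 16 * t * (2 + card (P u1) + card (P u2) + (t + 7) + (t + 7))"
      by (rule mult_le_mono2)
    also have "\<dots> = 16 * t * card (P u1) + 16 * t * card (P u2) + 16 * t * (2 * t + 16)"
      by (simp add: algebra_simps)
    finally have cH: "4 * t * card H \<le> n" using u1(2) u2(2) nt by linarith
    have QH: "Q l \<inter> H = {}" if l: "l \<in> I" for l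
    proof -
      have "\<tau> l \<noteq> j"
      proof
        assume "\<tau> l = j"
        then have "e (rb l) = e u1" using \<tau>[OF l] ij(4) by simp
        then show False using einj[OF rbU[OF IN[OF l]] u12(1)] rbi[OF l] by blast
      qed
      then have "A (\<tau> l) \<inter> A j = {}" using Adis \<tau>[OF l] ij(2) by blast
      moreover have "l \<noteq> i" using rbi(2)[OF l] ij(3) by blast
      then have "B l \<inter> B i = {}" using Bdis IN[OF l] ij(1) by blast
      moreover have "P (rb l) \<inter> B i = {}"
        using PB[OF rbU[OF IN[OF l]] ij(1)] rbi(2)[OF l] ij(3) by blast
      moreover have "P (rb l) \<inter> A j = {}"
      proof -
        have "e (rb l) \<noteq> ra j" using \<tau>[OF l] inj_onD[OF injA, of "\<tau> l" j] \<open>\<tau> l \<noteq> j\<close> ij(2) by auto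
        then show ?thesis using PA[OF rbU[OF IN[OF l]] ij(2)] by blast
      qed
      moreover have "B l \<inter> A j = {}" "A (\<tau> l) \<inter> B i = {}" using AB IN[OF l] ij \<tau>[OF l] by blast+
      ultimately have "Q l \<inter> (A j \<union> B i) = {}" unfolding Q_def by blast
      then show ?thesis
        using QP[OF l u12(1) rbi(1)[OF l]] QP[OF l u12(2) rbi(2)[OF l]] Qab[OF l] by (auto simp: H_def)
    qed
    have reach: "reaches E U b a" if U: "H \<subseteq> U" "U \<subseteq> V" "\<not> U \<subseteq> XA j \<union> XB i" for U
    proof -
      obtain w where w: "w \<in> U" "w \<notin> XA j" "w \<notin> XB i" using U(3) by blast
      have PU: "P u1 \<subseteq> U" "P u2 \<subseteq> U" "A j \<subseteq> U" "B i \<subseteq> U" using sub U(1) by auto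
      have "reaches E U b u1" using U(1) sub u12(3) P(2)[OF u12(1)] by (intro reaches_edge) auto
      also have "reaches E U u1 (ra j)" using P(4)[OF u12(1)] PU(1) ij(4) by (metis reaches_mono)
      also have "reaches E U (ra j) w"
      proof (cases "w \<in> A j")
        case True
        show ?thesis using A(4)[OF ij(2) True] PU(3) by (rule reaches_mono)
      next
        case False
        then obtain v where v: "v \<in> A j" "E v w" using w U(2) by (auto simp: XA_def)
        have "reaches E U (ra j) v" using A(4)[OF ij(2) v(1)] PU(3) by (rule reaches_mono)
        also have "reaches E U v w" using v w PU by (intro reaches_edge) auto
        finally show ?thesis .
      qed
      also have "reaches E U w (rb i)"
      proof (cases "w \<in> B i")
        case True
        show ?thesis using B(4)[OF ij(1) True] PU(4) by (rule reaches_mono)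
      next
        case False
        then obtain v where v: "v \<in> B i" "E w v" using w U(2) by (auto simp: XB_def)
        have "reaches E U w v" using v w PU by (intro reaches_edge) auto
        also have "reaches E U v (rb i)" using B(4)[OF ij(1) v(1)] PU(4) by (rule reaches_mono)
        finally show ?thesis .
      qed
      also have "reaches E U (rb i) (e u2)" using P(4)[OF u12(2)] PU(2) ij(3) by (metis reaches_mono)
      also have "reaches E U (e u2) a" using U(1) sub u12(4) P(3)[OF u12(2)] by (intro reaches_edge) auto
      finally show ?thesis .
    qed
    have "H \<subseteq> V" using PV[OF u12(1)] PV[OF u12(2)] A(1)[OF ij(2)] B(1)[OF ij(1)] ab by (auto simp: H_def)
    have "finite (XA j \<union> XB i)" using finV by (auto simp: XA_def XB_def)
    show ?thesis
      by (intro exI[of _ H] exI[of _ "XA j \<union> XB i"] conjI ballI allI impI sub(1,2) cH QH reach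
          cX[OF ij(2,1)] \<open>H \<subseteq> V\<close> \<open>finite (XA j \<union> XB i)\<close>)
  qed
  then obtain H X0 where H: "H \<subseteq> V" "a \<in> H" "b \<in> H" "\<forall>i\<in>I. Q i \<inter> H = {}" "4 * t * card H \<le> n"
      "finite X0" "16 * t * card X0 \<le> n" "\<forall>U. H \<subseteq> U \<longrightarrow> U \<subseteq> V \<longrightarrow> \<not> U \<subseteq> X0 \<longrightarrow> reaches E U b a"
    by (elim exE conjE) (rule that)
  show ?thesis
  proof (rule that[of I Q "\<lambda>i. XA (\<tau> i) \<union> XB i" H X0])
    show "finite I" by (simp add: I_def)
    show "finite (XA (\<tau> i) \<union> XB i)" for i using finV by (auto simp: XA_def XB_def)
    show "reaches E U b a" if "H \<subseteq> U" "U \<subseteq> V" "\<not> U \<subseteq> X0" for U using H(8) that by blast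
    show "\<exists>W. R \<subseteq> W \<and> W \<subseteq> Q i \<union> R \<and> strongly_connected_on W E"
      if "i \<in> I" "R \<subseteq> V - (XA (\<tau> i) \<union> XB i)" for i R using absorb[OF that] .
    show "16 * t * card (XA (\<tau> i) \<union> XB i) \<le> card V" if "i \<in> I" for i
      using cX[of "\<tau> i" i] \<tau>[OF that] IN[OF that] by (simp add: n_def)
  qed (use H(1-7) cI QV Qdis in \<open>simp_all add: n_def\<close>)
qed

section \<open>Prescribed cycle lengths\<close>

text \<open>Greedy choice: every \<open>S j\<close> has room for its own subset besides all the
  others.\<close>

lemma disjoint_subsets_of_sizes:
  assumes "finite J" "\<And>j. j \<in> J \<Longrightarrow> finite (S j)" "\<And>j. j \<in> J \<Longrightarrow> sum m J \<le> card (S j)"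
  shows "\<exists>R. (\<forall>j\<in>J. R j \<subseteq> S j \<and> card (R j) = m j) \<and> disjoint_family_on R J"
  using assms
proof (induction J rule: finite_induct)
  case empty
  then show ?case by (simp add: disjoint_family_on_def)
next
  case (insert x J)
  have "sum m J \<le> card (S j)" if "j \<in> J" for j
    using insert.prems(2)[of j] insert.hyps that by simp
  then obtain R where R: "\<forall>j\<in>J. R j \<subseteq> S j \<and> card (R j) = m j" "disjoint_family_on R J"
    using insert.IH insert.prems(1) by auto
  define U where "U = (\<Union>j\<in>J. R j)"
  have finU: "finite U" using R(1) insert.prems(1) insert.hyps by (auto simp: U_def intro: finite_subset)
  have "card U \<le> sum m J" using card_UN_le[OF insert.hyps(1), of R] R(1) by (simp add: U_def)
  moreover have "sum m J + m x \<le> card (S x)" using insert.prems(2)[of x] insert.hyps by simp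
  ultimately have "m x \<le> card (S x - U)"
    using diff_card_le_card_Diff[OF finU, of "S x"] by linarith
  then obtain Y where Y: "Y \<subseteq> S x - U" "card Y = m x" using obtain_subset_with_card_n by metis
  have "Y \<inter> R j = {}" if "j \<in> J" for j using Y(1) that by (auto simp: U_def)
  then have "disjoint_family_on (R(x := Y)) (insert x J)"
    using R(2) insert.hyps(2) unfolding disjoint_family_on_def by (simp add: Int_commute)
  moreover have "\<forall>j\<in>insert x J. (R(x := Y)) j \<subseteq> S j \<and> card ((R(x := Y)) j) = m j"
    using R(1) Y insert.hyps(2) by auto
  ultimately show ?case by blast
qed

text \<open>For the least possible \<open>r\<close>, \<open>2 ^ r < 2 * n\<close> and hence
  \<open>r\<^sup>2 \<le> 2 * 2 ^ r \<le> 4 * n\<close>. The claim follows on squaring, because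
  \<open>2 ^ 20 * t\<^sup>2 \<le> n\<close>.\<close>

lemma logarithmic_bound:
  assumes "2 \<le> (t :: nat)" "10 ^ 10 * t ^ 4 \<le> n"
  obtains r where "1 \<le> r" "n \<le> 2 ^ r" "512 * t * r \<le> n"
proof -
  have ex: "\<exists>r. n \<le> 2 ^ r" using less_exp less_imp_le by blast
  define r where "r = (LEAST r. n \<le> 2 ^ r)"
  have r: "n \<le> 2 ^ r" unfolding r_def using ex by (rule LeastI_ex)
  have "16 \<le> t ^ 4" using power_mono[OF assms(1), of 4] by simp
  then have n: "2 \<le> n" using assms(2) by simp
  then have r1: "1 \<le> r" using r by (cases r) auto
  then have "r - 1 < (LEAST r. n \<le> 2 ^ r)" by (simp add: r_def)
  then have "\<not> n \<le> 2 ^ (r - 1)" by (rule not_less_Least)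
  then have "2 ^ r < 2 * n" using r1 by (cases r) auto
  moreover have "m\<^sup>2 \<le> 2 * 2 ^ m" for m :: nat
  proof (induction m rule: less_induct)
    case (less m)
    show ?case
    proof (cases "m \<le> 3")
      case True
      then have "m = 0 \<or> m = 1 \<or> m = 2 \<or> m = 3" by auto
      then show ?thesis by auto
    next
      case False
      then obtain l where l: "m = Suc l" "3 \<le> l" by (cases m) auto
      have "3 * l \<le> l * l" using l(2) by (rule mult_le_mono1)
      then have "Suc (l + l) \<le> l * l" using l(2) by linarith
      then have "(Suc l)\<^sup>2 \<le> 2 * l\<^sup>2" by (simp add: power2_eq_square)
      also have "\<dots> \<le> 2 * (2 * 2 ^ l)" using less[of l] l(1) by simp
      finally show ?thesis using l(1) by simp
    qed
  qed
  then have "r\<^sup>2 \<le> 2 * 2 ^ r" .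
  ultimately have r2: "r\<^sup>2 \<le> 4 * n" by linarith
  have "t\<^sup>2 \<le> t ^ 4" using assms(1) by (intro power_increasing) auto
  then have t2: "1048576 * t\<^sup>2 \<le> n" using assms(2) by simp
  have "(512 * t * r)\<^sup>2 = 262144 * t\<^sup>2 * r\<^sup>2" by (simp add: power_mult_distrib)
  also have "\<dots> \<le> 262144 * t\<^sup>2 * (4 * n)" using r2 by (rule mult_le_mono2)
  also have "\<dots> = 1048576 * t\<^sup>2 * n" by simp
  also have "\<dots> \<le> n\<^sup>2" using mult_le_mono1[OF t2, of n] by (simp add: power2_eq_square)
  finally have "512 * t * r \<le> n" by (rule power2_le_imp_le) simp
  with r r1 show ?thesis using that by blast
qed

theorem prescribed_cycle_factor:
  fixes V :: "'a set" and L :: "nat \<Rightarrow> nat"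
  assumes T: "tournament V E" and t: "2 \<le> t" and L3: "\<And>j. j \<in> {1..t} \<Longrightarrow> 3 \<le> L j"
    and Ln: "(\<Sum>j=1..t. L j) = card V"
    and conn: "strongly_k_connected k V E" and k: "10 ^ 10 * t ^ 4 \<le> k"
  shows "\<exists>C. (\<forall>j\<in>{1..t}. directed_cycle E (C j) \<and> length (C j) = L j \<and> set (C j) \<subseteq> V) \<and>
             (\<forall>i\<in>{1..t}. \<forall>j\<in>{1..t}. i \<noteq> j \<longrightarrow> set (C i) \<inter> set (C j) = {})"
proof -
  define n where "n = card V"
  have finV: "finite V" using T by (simp add: tournament_def)
  have kn: "k < n" using conn by (simp add: strongly_k_connected_def n_def)
  have n0: "0 < n" using kn by simp
  have "10 ^ 10 * t ^ 4 \<le> n" using k kn by linarith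
  then obtain r where r: "1 \<le> r" "card V \<le> 2 ^ r" "512 * t * r \<le> n"
    using logarithmic_bound[OF t] unfolding n_def by metis
  obtain v0 where v0: "v0 \<in> V" using n0 by (auto simp: n_def card_gt_0_iff)
  obtain a where a: "a \<in> V" "\<And>v. v \<in> V \<Longrightarrow> card {u. E u a} \<le> card {u. E u v}"
    using ex_has_least_nat[of "\<lambda>v. v \<in> V", OF v0, of "\<lambda>v. card {u. E u v}"] by blast
  obtain b where b: "b \<in> V" "\<And>v. v \<in> V \<Longrightarrow> card {u. E b u} \<le> card {u. E v u}"
    using ex_has_least_nat[of "\<lambda>v. v \<in> V", OF v0, of "\<lambda>v. card {u. E v u}"] by blast
  from linked_dominating_sets[OF T t conn k a(1) b(1)]
  obtain I :: "nat set" and Q X :: "nat \<Rightarrow> 'a set" and H X0 :: "'a set" where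
    I: "finite I" "80 * t\<^sup>2 \<le> card I" and
    Q: "\<And>i. i \<in> I \<Longrightarrow> Q i \<subseteq> V" "disjoint_family_on Q I" and
    finX: "\<And>i. i \<in> I \<Longrightarrow> finite (X i)" and
    X: "\<And>i. i \<in> I \<Longrightarrow> 16 * t * card (X i) \<le> card V"
      "\<And>i R. i \<in> I \<Longrightarrow> R \<subseteq> V - X i \<Longrightarrow> \<exists>W. R \<subseteq> W \<and> W \<subseteq> Q i \<union> R \<and> strongly_connected_on W E" and
    H: "H \<subseteq> V" "a \<in> H" "b \<in> H" "\<And>i. i \<in> I \<Longrightarrow> Q i \<inter> H = {}" "4 * t * card H \<le> card V" and
    X0: "finite X0" "16 * t * card X0 \<le> card V"
      "\<And>U. H \<subseteq> U \<Longrightarrow> U \<subseteq> V \<Longrightarrow> \<not> U \<subseteq> X0 \<Longrightarrow> reaches E U b a"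
    by blast
  have abQ: "a \<notin> Q i" "b \<notin> Q i" if "i \<in> I" for i using H(2-4) that by blast+
  from robust_reachability[OF T a r(2,1) I(1) Q(2) abQ(1)] obtain \<omega> :: "nat \<Rightarrow> real" where \<omega>: "\<And>i. i \<in> I \<Longrightarrow> 0 \<le> \<omega> i" "sum \<omega> I \<le> 2"
    "\<And>J. J \<subseteq> I \<Longrightarrow> sum \<omega> J < 1 / 4 \<Longrightarrow> \<exists>G\<subseteq>V. card G \<le> 16 * r \<and> (\<forall>i\<in>J. G \<inter> Q i = {}) \<and>
        (\<forall>U v. insert a G \<subseteq> U \<longrightarrow> U \<subseteq> V \<longrightarrow> v \<in> U \<longrightarrow> reaches E U a v)"
    by blast
  from robust_reachability[OF tournament_reverse[OF T] b r(2,1) I(1) Q(2) abQ(2), unfolded reaches_reverse[of E]]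
  obtain \<omega>' :: "nat \<Rightarrow> real" where \<omega>': "\<And>i. i \<in> I \<Longrightarrow> 0 \<le> \<omega>' i" "sum \<omega>' I \<le> 2"
    "\<And>J. J \<subseteq> I \<Longrightarrow> sum \<omega>' J < 1 / 4 \<Longrightarrow> \<exists>G\<subseteq>V. card G \<le> 16 * r \<and> (\<forall>i\<in>J. G \<inter> Q i = {}) \<and>
        (\<forall>U v. insert b G \<subseteq> U \<longrightarrow> U \<subseteq> V \<longrightarrow> v \<in> U \<longrightarrow> reaches E U v b)"
    by blast
  have finQ: "finite (Q i)" if "i \<in> I" for i using Q(1)[OF that] finV by (rule finite_subset)
  \<comment> \<open>One weight for all three requirements: harm to the family of \<open>a\<close>,
    harm to that of \<open>b\<close>, and size. The total is at most 2 + 2 + 1.\<close>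
  define \<rho> where "\<rho> i = \<omega> i + \<omega>' i + card (Q i) / n" for i
  have "(\<Sum>i\<in>I. card (Q i)) = card (\<Union>i\<in>I. Q i)"
    using I(1) finQ Q(2) by (intro card_UN_disjoint[symmetric]) (auto simp: disjoint_family_on_def)
  also have "\<dots> \<le> n" unfolding n_def using Q(1) finV by (intro card_mono) auto
  finally have "(\<Sum>i\<in>I. card (Q i) / n) \<le> 1"
    using n0 by (simp add: sum_divide_distrib[symmetric] divide_le_eq flip: of_nat_sum)
  then have \<rho>5: "sum \<rho> I \<le> 5" using \<omega>(2) \<omega>'(2) by (simp add: \<rho>_def sum.distrib)
  have \<rho>0: "0 \<le> \<rho> i" if "i \<in> I" for i using \<omega>(1) \<omega>'(1) that by (simp add: \<rho>_def)
  have tt: "t \<le> t\<^sup>2" using t by (simp add: power2_eq_square)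
  have "2 * (t - 1) \<le> card I" using I(2) tt by linarith
  \<comment> \<open>From \<open>80 * t\<^sup>2\<close> pairs of total weight at most 5, the chosen
    ones weigh at most \<open>10 * t / (80 * t\<^sup>2) = 1 / (8 * t)\<close>; this is below
    \<open>1 / 4\<close> and bounds their union by \<open>n / (8 * t)\<close>.\<close>
  then obtain J where J: "J \<subseteq> I" "card J = t - 1" "sum \<rho> J * card I \<le> 2 * 5 * real (t - 1)"
    using light_subset[OF I(1) _ \<rho>0 \<rho>5, of "t - 1"] by (metis zero_less_numeral)
  have finJ: "finite J" using J(1) I(1) by (rule finite_subset)
  have "sum \<rho> J * (80 * real t * real t) \<le> sum \<rho> J * card I"
    using I(2) \<rho>0 J(1) of_nat_mono[OF I(2), where ?'a = real]
    by (intro mult_left_mono sum_nonneg) (auto simp: power2_eq_square)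
  also have "\<dots> \<le> 10 * real t" using J(3) by simp
  finally have "real t * (sum \<rho> J * (8 * t)) \<le> real t * 1" by (simp add: mult_ac)
  then have \<rho>J: "sum \<rho> J * (8 * t) \<le> 1" using t by simp
  have J0: "0 \<le> sum \<omega> J" "0 \<le> sum \<omega>' J" "0 \<le> (\<Sum>i\<in>J. card (Q i) / n)"
    using \<omega>(1) \<omega>'(1) J(1) by (auto intro!: sum_nonneg)
  have \<rho>_sum: "sum \<rho> J = sum \<omega> J + sum \<omega>' J + (\<Sum>i\<in>J. card (Q i) / n)" by (simp add: \<rho>_def sum.distrib)
  have "sum \<rho> J * 16 \<le> sum \<rho> J * (8 * t)" using t J0 \<rho>_sum by (intro mult_left_mono) auto
  then have "sum \<rho> J < 1 / 4" using \<rho>J by linarith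
  then have lt: "sum \<omega> J < 1 / 4" "sum \<omega>' J < 1 / 4" using J0 \<rho>_sum by linarith+
  have "(\<Sum>i\<in>J. card (Q i) / n) * (8 * t) \<le> sum \<rho> J * (8 * t)"
    using J0 \<rho>_sum by (intro mult_right_mono) auto
  then have "real (\<Sum>i\<in>J. card (Q i)) / n * (8 * t) \<le> 1"
    using \<rho>J by (simp add: sum_divide_distrib)
  then have "real (8 * t * (\<Sum>i\<in>J. card (Q i))) \<le> real n" using n0 by (simp add: divide_le_eq mult_ac)
  then have QJ: "8 * t * (\<Sum>i\<in>J. card (Q i)) \<le> n" by (simp only: of_nat_le_iff)
  obtain G where G: "G \<subseteq> V" "card G \<le> 16 * r" "\<forall>i\<in>J. G \<inter> Q i = {}"
      "\<And>U v. insert a G \<subseteq> U \<Longrightarrow> U \<subseteq> V \<Longrightarrow> v \<in> U \<Longrightarrow> reaches E U a v"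
    using \<omega>(3)[OF J(1) lt(1)] by blast
  obtain G' where G': "G' \<subseteq> V" "card G' \<le> 16 * r" "\<forall>i\<in>J. G' \<inter> Q i = {}"
      "\<And>U v. insert b G' \<subseteq> U \<Longrightarrow> U \<subseteq> V \<Longrightarrow> v \<in> U \<Longrightarrow> reaches E U v b"
    using \<omega>'(3)[OF J(1) lt(2)] by blast
  have "Max (L ` {1..t}) \<in> L ` {1..t}" using t by (intro Max_in) auto
  then obtain l where l: "l \<in> {1..t}" "L l = Max (L ` {1..t})" by (metis imageE)
  have Ll: "n \<le> t * L l" using sum_bounded_above[of "{1..t}" L "L l"] Ln unfolding l(2) by (simp add: n_def)
  define K where "K = {1..t} - {l}"
  have cK: "finite K" "card K = t - 1" using l(1) by (auto simp: K_def)
  obtain \<phi> where \<phi>: "bij_betw \<phi> K J" using finite_same_card_bij[OF cK(1) finJ] cK(2) J(2) by auto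
  have \<phi>J: "\<phi> j \<in> J" if "j \<in> K" for j using \<phi> that by (auto simp: bij_betw_def)
  have \<phi>I: "\<phi> j \<in> I" if "j \<in> K" for j using \<phi>J[OF that] J(1) by blast
  have LK: "sum L K + L l = n"
    using Ln sum.remove[of "{1..t}" l L] l(1) by (simp add: K_def n_def)
  define Res where "Res = H \<union> G \<union> G'"
  define QQ where "QQ = (\<Union>i\<in>J. Q i)"
  have "card Res \<le> card H + card G + card G'"
    unfolding Res_def by (intro order_trans[OF card_Un_le] add_mono) auto
  then have cRes: "16 * t * card Res \<le> 16 * t * (card H + 32 * r)"
    using G(2) G'(2) by (intro mult_le_mono2) linarith
  have "card QQ \<le> (\<Sum>i\<in>J. card (Q i))" unfolding QQ_def using finJ by (rule card_UN_le)
  then have cQQ: "16 * t * card QQ \<le> 16 * t * (\<Sum>i\<in>J. card (Q i))" by (rule mult_le_mono2)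
  \<comment> \<open>The budget, multiplied by \<open>16 * t\<close>: \<open>H\<close> costs
    \<open>4 * n\<close>, \<open>G\<close> and \<open>G'\<close> together \<open>n\<close>, the
    pairs \<open>2 * n\<close>, and \<open>X (\<phi> j)\<close> another \<open>n\<close>. So at most
    \<open>n / (2 * t) \<le> L l\<close> vertices are forbidden, and \<open>n - L l\<close>
    remain.\<close>
  have avail: "sum L K \<le> card (V - (Res \<union> QQ \<union> X (\<phi> j)) )" if j: "j \<in> K" for j
  proof -
    define D where "D = V \<inter> (Res \<union> QQ \<union> X (\<phi> j))"
    have "finite (Res \<union> QQ \<union> X (\<phi> j))"
      using finX[OF \<phi>I[OF j]] finV H(1) G(1) G'(1) finJ finQ J(1)
      by (auto simp: Res_def QQ_def intro: finite_subset)
    then have "card D \<le> card (Res \<union> QQ \<union> X (\<phi> j))" unfolding D_def by (intro card_mono) auto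
    also have "\<dots> \<le> card Res + card QQ + card (X (\<phi> j))"
      by (intro order_trans[OF card_Un_le] add_mono) auto
    finally have "16 * t * card D \<le> 16 * t * (card Res + card QQ + card (X (\<phi> j)))" by (rule mult_le_mono2)
    also have "\<dots> = 16 * t * card Res + 16 * t * card QQ + 16 * t * card (X (\<phi> j))" by (simp add: distrib_left)
    also have "\<dots> \<le> 8 * n"
      using cRes cQQ QJ X(1)[OF \<phi>I[OF j]] H(5) r(3) unfolding n_def[symmetric] distrib_left by linarith
    also have "\<dots> \<le> 16 * t * L l" using Ll by simp
    finally have "card D \<le> L l" using t by simp
    moreover have "card (V - D) = n - card D"
      unfolding n_def using finV by (intro card_Diff_subset) (auto simp: D_def)
    moreover have "V - D = V - (Res \<union> QQ \<union> X (\<phi> j))" by (auto simp: D_def)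
    ultimately show ?thesis using LK by simp
  qed
  obtain R where R: "\<And>j. j \<in> K \<Longrightarrow> R j \<subseteq> V - (Res \<union> QQ \<union> X (\<phi> j))" "\<And>j. j \<in> K \<Longrightarrow> card (R j) = L j"
      "disjoint_family_on R K"
    using disjoint_subsets_of_sizes[OF cK(1), of "\<lambda>j. V - (Res \<union> QQ \<union> X (\<phi> j))" L] avail finV by blast
  \<comment> \<open>\<open>R j\<close> alone already has \<open>L j\<close> vertices, so
    \<open>W\<close> is large enough. The cycle may skip vertices of \<open>R j\<close> and use
    vertices of the pair instead; those it skips pass to \<open>U\<close>.\<close>
  have "\<exists>c. directed_cycle E c \<and> length c = L j \<and> set c \<subseteq> Q (\<phi> j) \<union> R j" if j: "j \<in> K" for j
  proof -
    have "R j \<subseteq> V - X (\<phi> j)" using R(1)[OF j] by blast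
    from X(2)[OF \<phi>I[OF j] this] obtain W where
      W: "R j \<subseteq> W" "W \<subseteq> Q (\<phi> j) \<union> R j" "strongly_connected_on W E" by blast
    have WV: "W \<subseteq> V" using W(2) Q(1)[OF \<phi>I[OF j]] R(1)[OF j] by blast
    then have "L j \<le> card W" using card_mono[OF finite_subset[OF WV finV] W(1)] R(2)[OF j] by simp
    moreover have "3 \<le> L j" using L3 j by (simp add: K_def)
    ultimately show ?thesis
      using strongly_connected_cycle_of_length[OF T WV W(3)] W(2) by blast
  qed
  then obtain C where C: "\<And>j. j \<in> K \<Longrightarrow> directed_cycle E (C j)" "\<And>j. j \<in> K \<Longrightarrow> length (C j) = L j"
      "\<And>j. j \<in> K \<Longrightarrow> set (C j) \<subseteq> Q (\<phi> j) \<union> R j" by metis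
  have CV: "set (C j) \<subseteq> V" if "j \<in> K" for j
    using C(3)[OF that] Q(1)[OF \<phi>I[OF that]] R(1)[OF that] by blast
  have Cdis: "set (C i) \<inter> set (C j) = {}" if ij: "i \<in> K" "j \<in> K" "i \<noteq> j" for i j
  proof -
    have "\<phi> i \<noteq> \<phi> j" using \<phi> ij by (auto simp: bij_betw_def inj_on_def)
    then have "Q (\<phi> i) \<inter> Q (\<phi> j) = {}" using Q(2) \<phi>I ij by (auto simp: disjoint_family_on_def)
    moreover have "R i \<inter> R j = {}" using R(3) ij by (auto simp: disjoint_family_on_def)
    moreover have "Q (\<phi> i) \<inter> R j = {}" "Q (\<phi> j) \<inter> R i = {}"
      using R(1) \<phi>J ij unfolding QQ_def by blast+
    ultimately show ?thesis using C(3)[OF ij(1)] C(3)[OF ij(2)] by blast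
  qed
  define U where "U = V - (\<Union>j\<in>K. set (C j))"
  have "card (\<Union>j\<in>K. set (C j)) = (\<Sum>j\<in>K. card (set (C j)))"
    using cK(1) Cdis by (intro card_UN_disjoint) auto
  also have "\<dots> = sum L K"
    using C(1,2) by (intro sum.cong) (auto simp: directed_cycle_def distinct_card)
  finally have "card U = L l"
    unfolding U_def using LK CV cK(1) by (subst card_Diff_subset) (auto simp: n_def[symmetric])
  have UV: "U \<subseteq> V" by (simp add: U_def)
  have "Res \<inter> set (C j) = {}" if j: "j \<in> K" for j
  proof -
    have "Res \<inter> Q (\<phi> j) = {}" using H(4)[OF \<phi>I[OF j]] G(3) G'(3) \<phi>J[OF j] by (auto simp: Res_def)
    then show ?thesis using C(3)[OF j] R(1)[OF j] by blast
  qed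
  moreover have "Res \<subseteq> V" using H(1) G(1) G'(1) by (simp add: Res_def)
  ultimately have ResU: "Res \<subseteq> U" unfolding U_def by blast
  have "strongly_connected_on U E"
  proof (rule strongly_connected_onI)
    show "reaches E U a v" if "v \<in> U" for v using G(4)[OF _ UV that] ResU H(2) by (auto simp: Res_def)
    show "reaches E U v b" if "v \<in> U" for v using G'(4)[OF _ UV that] ResU H(3) by (auto simp: Res_def)
    \<comment> \<open>\<open>U\<close> has \<open>L l \<ge> n / t\<close> vertices, while
      \<open>X0\<close> has at most \<open>n / (16 * t)\<close>.\<close>
    have "\<not> U \<subseteq> X0"
    proof
      assume "U \<subseteq> X0"
      then have "L l \<le> card X0" using card_mono[OF X0(1)] \<open>card U = L l\<close> by metis
      then have "16 * (t * L l) \<le> 16 * t * card X0" by simp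
      then show False using X0(2) Ll n0 unfolding n_def[symmetric] by linarith
    qed
    then show "reaches E U b a" using X0(3)[of U] ResU UV by (auto simp: Res_def)
  qed
  then obtain c where c: "directed_cycle E c" "length c = L l" "set c \<subseteq> U"
    using strongly_connected_cycle_of_length[OF T UV, of "L l"] L3[OF l(1)] \<open>card U = L l\<close> by auto
  have cC: "set c \<inter> set (C j) = {}" if "j \<in> K" for j using c(3) that by (auto simp: U_def)
  show ?thesis
  proof (intro exI[of _ "C(l := c)"] conjI ballI impI)
    fix j assume "j \<in> {1..t}"
    then have "j = l \<or> j \<in> K \<and> j \<noteq> l" by (auto simp: K_def)
    then show "directed_cycle E ((C(l := c)) j)" "length ((C(l := c)) j) = L j" "set ((C(l := c)) j) \<subseteq> V"
      using c UV C(1,2)[of j] CV[of j] by auto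
  next
    fix i j assume "i \<in> {1..t}" "j \<in> {1..t}" "i \<noteq> j"
    then have "i \<in> K \<and> i \<noteq> l \<or> i = l" "j \<in> K \<and> j \<noteq> l \<or> j = l" "i \<noteq> j" by (auto simp: K_def)
    then show "set ((C(l := c)) i) \<inter> set ((C(l := c)) j) = {}"
      using Cdis[of i j] cC[of i] cC[of j] by (auto simp: Int_commute)
  qed
qed

theorem theorem1p7:
  fixes V :: "'a set" and E :: "'a \<Rightarrow> 'a \<Rightarrow> bool" and n t :: nat and L :: "nat \<Rightarrow> nat"
  assumes "tournament V E"
    and "card V = n"
    and "t \<ge> 2"
    and "\<forall>j\<in>{1..t}. L j \<ge> 3"
    and "(\<Sum>j=1..t. L j) = n"
    and "strongly_k_connected (nat \<lceil>10^10 * real t ^ 4 * log 2 (real t)\<rceil>) V E"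
  shows "\<exists>C :: nat \<Rightarrow> 'a list.
           (\<forall>j\<in>{1..t}. directed_cycle E (C j) \<and> length (C j) = L j \<and> set (C j) \<subseteq> V)
         \<and> (\<forall>i\<in>{1..t}. \<forall>j\<in>{1..t}. i \<noteq> j \<longrightarrow> set (C i) \<inter> set (C j) = {})"
proof -
  have "1 \<le> log 2 (real t)" using assms(3) by (simp add: le_log_iff)
  then have "10 ^ 10 * real t ^ 4 * 1 \<le> 10 ^ 10 * real t ^ 4 * log 2 (real t)"
    by (intro mult_left_mono) auto
  also note real_nat_ceiling_ge
  also have "10 ^ 10 * real t ^ 4 * 1 = real (10 ^ 10 * t ^ 4)" by simp
  finally have "10 ^ 10 * t ^ 4 \<le> nat \<lceil>10 ^ 10 * real t ^ 4 * log 2 (real t)\<rceil>"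
    by (simp only: of_nat_le_iff)
  then show ?thesis
    using prescribed_cycle_factor[OF assms(1,3) _ _ assms(6)] assms(2,4,5) by simp
qed

end
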